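(* Let $k$ be a field, let $S=k[x_1,\dots,x_n]$, and let $I\subseteq S$ be a monomial ideal. Then $\mathrm{pd}_S(I)\le 1$ if and only if $S/I$ has a minimal free resolution supported on a tree (in the sense of graph theory).
   Context: $\mathrm{pd}_S(I)$ is the projective dimension of $I$ as an $S$-module, that is, the largest $i$ for which the $i$-th free module in the minimal free resolution of $I$ over $S$ is nonzero. A free resolution $\mathbf F$ of an $S$-module, with free modules $F_i$ and differentials $\partial_i:F_i\to F_{i-1}$, is minimal if $\partial_{i+1}(F_{i+1})\subseteq \mathbf{m}F_i$ for all $i\ge 0$, where $\mathbf m=(x_1,\dots,x_n)$. Resolutions supported on a tree. Let $m_1,\dots,m_r$ be the minimal monomial generators of $I$, and let $T$ be a tree (connected acyclic graph; a single vertex with no edges is allowed) with $r$ vertices $v_1,\dots,v_r$, where $v_i$ is labeled by $m_i$ and each edge is labeled by the least common multiple of the labels of its two vertices. The associated complex ($I$-homogenization of the augmented simplicial chain complex of $T$ over $k$) is $$0\to\bigoplus_{\{v_i,v_j\}\text{ edge of }T} S\,e_{ij}\ \xrightarrow{d_2}\ \bigoplus_{i=1}^r S\,e_i\ \xrightarrow{d_1}\ S\to 0,$$ with $d_1(e_i)=m_i$ and, for each edge $\{v_i,v_j\}$ with $i<j$, $d_2(e_{ij})=\frac{\mathrm{lcm}(m_i,m_j)}{m_i}e_i-\frac{\mathrm{lcm}(m_i,m_j)}{m_j}e_j$. One says $S/I$ has a (minimal) free resolution supported on a tree if for some such labeled tree $T$ this complex is a (minimal) free resolution of $S/I$.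
   Formalization: The monomial ideal I is assumed proper (I ≠ S): for I = S the claim fails, since pd_S(S) = 0 but the only candidate complex 0→S→S→0 with d_1 = 1 is not minimal. *)

theory Defs
  imports "HOL-Library.Poly_Mapping" "HOL-Library.Extended_Nat"
begin

text \<open>
  The polynomial ring in the variables indexed by the finite type \<open>'n\<close> is the monoid algebra of
  exponent vectors: \<open>single a c\<close> is the term with exponent \<open>a\<close> and coefficient \<open>c\<close>.
\<close>

type_synonym 'n exponent = "'n \<Rightarrow>\<^sub>0 nat"
type_synonym ('n, 'k) polynomial = "'n exponent \<Rightarrow>\<^sub>0 'k"

definition monomial :: "'n exponent \<Rightarrow> ('n, 'k::field) polynomial" where
  "monomial a = Poly_Mapping.single a 1"

definition variable :: "'n \<Rightarrow> ('n, 'k::field) polynomial" where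
  "variable i = monomial (Poly_Mapping.single i 1)"

definition ideal_gen :: "('n, 'k::field) polynomial set \<Rightarrow> ('n, 'k) polynomial set" where
  "ideal_gen G = module.span (*) G"

definition max_ideal :: "('n, 'k::field) polynomial set" where
  "max_ideal = ideal_gen (variable ` UNIV)"

definition monomial_ideal :: "('n, 'k::field) polynomial set \<Rightarrow> bool" where
  "monomial_ideal I \<longleftrightarrow> (\<exists>A. I = ideal_gen (monomial ` A))"

text \<open>\<open>m 0, \<dots>, m (r - 1)\<close> lists, without repetition, the exponents of the minimal monomial
  generators of \<open>I\<close>.\<close>

definition min_mono_gens ::
  "('n, 'k::field) polynomial set \<Rightarrow> nat \<Rightarrow> (nat \<Rightarrow> 'n exponent) \<Rightarrow> bool" where
  "min_mono_gens I r m \<longleftrightarrow>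
     inj_on m {..<r} \<and> I = ideal_gen (monomial ` m ` {..<r}) \<and>
     (\<forall>A. A \<subset> m ` {..<r} \<longrightarrow> I \<noteq> ideal_gen (monomial ` A))"

lift_definition lcm_exp :: "'n exponent \<Rightarrow> 'n exponent \<Rightarrow> 'n exponent"
  is "\<lambda>a b i. max (a i) (b i)"
proof -
  fix a b :: "'n \<Rightarrow> nat"
  assume "finite {i. a i \<noteq> 0}" "finite {i. b i \<noteq> 0}"
  then have "finite ({i. a i \<noteq> 0} \<union> {i. b i \<noteq> 0})" by simp
  then show "finite {i. max (a i) (b i) \<noteq> 0}"
    by (rule rev_finite_subset) (auto simp: max_def)
qed


text \<open>
  A sequence of free modules of finite rank is given by finite sets \<open>B i\<close> of basis elements of
  \<open>F\<^sub>i\<close>, and the differential \<open>\<partial>\<^sub>i : F\<^sub>i \<rightarrow> F\<^sub>i\<^sub>-\<^sub>1\<close> (for \<open>i \<ge> 1\<close>) by a matrix \<open>D i\<close>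
  whose rows are indexed by \<open>B (i - 1)\<close> and whose columns are indexed by \<open>B i\<close>. Matrix entries
  outside these index sets are irrelevant.
\<close>

definition free_module :: "'b set \<Rightarrow> ('b \<Rightarrow> ('n, 'k::field) polynomial) set" where
  "free_module B = {v. \<forall>b. b \<notin> B \<longrightarrow> v b = 0}"

definition differential ::
  "(nat \<Rightarrow> 'b set) \<Rightarrow> (nat \<Rightarrow> 'b \<Rightarrow> 'b \<Rightarrow> ('n, 'k::field) polynomial)
    \<Rightarrow> nat \<Rightarrow> ('b \<Rightarrow> ('n, 'k) polynomial) \<Rightarrow> ('b \<Rightarrow> ('n, 'k) polynomial)" where
  "differential B D i v = (\<lambda>a. if a \<in> B (i - 1) then \<Sum>b\<in>B i. D i a b * v b else 0)"

text \<open>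
  Both the ideal \<open>I\<close> and the quotient \<open>S/I\<close> are subquotients \<open>X/Y\<close> of \<open>S\<close>, namely \<open>I/0\<close> and \<open>S/I\<close>;
  resolutions are defined for such modules. An augmentation \<open>F\<^sub>0 \<rightarrow> X/Y\<close> is given by representatives
  \<open>e b \<in> X\<close> of the images of the basis elements. The conditions below say that it is onto \<open>X/Y\<close>,
  that its kernel is the image of \<open>\<partial>\<^sub>1\<close>, and that the complex is exact at \<open>F\<^sub>i\<close> for \<open>i \<ge> 1\<close>.
\<close>

definition free_resolution ::
  "('n, 'k::field) polynomial set \<Rightarrow> ('n, 'k) polynomial set
    \<Rightarrow> (nat \<Rightarrow> 'b set) \<Rightarrow> (nat \<Rightarrow> 'b \<Rightarrow> 'b \<Rightarrow> ('n, 'k) polynomial) \<Rightarrow> bool" where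
  "free_resolution X Y B D \<longleftrightarrow>
     (\<forall>i. finite (B i)) \<and>
     (\<exists>e. e ` B 0 \<subseteq> X \<and>
        {(\<Sum>b\<in>B 0. v b * e b) + y |v y. v \<in> free_module (B 0) \<and> y \<in> Y} = X \<and>
        {v \<in> free_module (B 0). (\<Sum>b\<in>B 0. v b * e b) \<in> Y}
          = differential B D 1 ` free_module (B 1)) \<and>
     (\<forall>i\<ge>1. {v \<in> free_module (B i). differential B D i v = (\<lambda>_. 0)}
          = differential B D (i + 1) ` free_module (B (i + 1)))"

text \<open>As \<open>F\<^sub>i\<close> is free on the finite set \<open>B i\<close>, the submodule \<open>\<^bold>m F\<^sub>i\<close> consists of the vectors
  with all coordinates in \<open>\<^bold>m\<close>.\<close>

definition min_free_resolution ::
  "('n, 'k::field) polynomial set \<Rightarrow> ('n, 'k) polynomial set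
    \<Rightarrow> (nat \<Rightarrow> 'b set) \<Rightarrow> (nat \<Rightarrow> 'b \<Rightarrow> 'b \<Rightarrow> ('n, 'k) polynomial) \<Rightarrow> bool" where
  "min_free_resolution X Y B D \<longleftrightarrow>
     free_resolution X Y B D \<and>
     (\<forall>i. differential B D (i + 1) ` free_module (B (i + 1))
            \<subseteq> {v \<in> free_module (B i). \<forall>b. v b \<in> max_ideal})"

text \<open>
  The largest \<open>i\<close> with \<open>F\<^sub>i \<noteq> 0\<close> in a minimal free resolution of \<open>X/Y\<close>. All minimal free
  resolutions of a module have the same ranks (the rank of \<open>F\<^sub>i\<close> is the dimension of
  \<open>Tor\<^sub>i(X/Y, S/\<^bold>m)\<close>), so the infimum only selects their common value. The zero module gets the
  value \<open>0\<close>.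
\<close>

definition proj_dim ::
  "('n, 'k::field) polynomial set \<Rightarrow> ('n, 'k) polynomial set \<Rightarrow> enat" where
  "proj_dim X Y =
     Inf {Sup (enat ` {i. B i \<noteq> {}}) |B D. 
            min_free_resolution X Y (B :: nat \<Rightarrow> nat set) D}"


text \<open>
  Simple graphs have vertex set \<open>V\<close> and a set \<open>E\<close> of two-element subsets of \<open>V\<close> as edges.
  For \<open>V = {}\<close> connectedness is vacuous.
\<close>

definition graph :: "'v set \<Rightarrow> 'v set set \<Rightarrow> bool" where
  "graph V E \<longleftrightarrow> (\<forall>e\<in>E. e \<subseteq> V \<and> card e = 2)"

definition connected_graph :: "'v set \<Rightarrow> 'v set set \<Rightarrow> bool" where
  "connected_graph V E \<longleftrightarrow> (\<forall>u\<in>V. \<forall>v\<in>V. (u, v) \<in> {(x, y). {x, y} \<in> E}\<^sup>*)"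

definition cycle :: "'v set set \<Rightarrow> 'v list \<Rightarrow> bool" where
  "cycle E p \<longleftrightarrow> length p \<ge> 3 \<and> distinct p \<and>
     (\<forall>i. i + 1 < length p \<longrightarrow> {p ! i, p ! (i + 1)} \<in> E) \<and> {last p, hd p} \<in> E"

definition tree :: "'v set \<Rightarrow> 'v set set \<Rightarrow> bool" where
  "tree V E \<longleftrightarrow> graph V E \<and> connected_graph V E \<and> (\<nexists>p. cycle E p)"

text \<open>
  The homogenized augmented chain complex of a graph on the vertices \<open>0, \<dots>, r - 1\<close>, labelled by
  \<open>m\<close>. The basis elements are the faces: \<open>{}\<close> in degree 0, \<open>{i}\<close> in degree 1, edges in degree 2.
  The exponent \<open>l - m i\<close> is that of the monomial \<open>lcm(m\<^sub>i, m\<^sub>j) / m\<^sub>i\<close>.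
\<close>

definition graph_basis :: "nat \<Rightarrow> nat set set \<Rightarrow> nat \<Rightarrow> nat set set" where
  "graph_basis r E i =
     (if i = 0 then {{}} else if i = 1 then {{j} |j. j < r} else if i = 2 then E else {})"

definition graph_diff ::
  "(nat \<Rightarrow> 'n exponent) \<Rightarrow> nat \<Rightarrow> nat set \<Rightarrow> nat set \<Rightarrow> ('n, 'k::field) polynomial" where
  "graph_diff m i a b =
     (if i = 1 then monomial (m (the_elem b))
      else if i = 2 then
        (let l = lcm_exp (m (Min b)) (m (Max b))
         in if a = {Min b} then monomial (l - m (Min b))
            else if a = {Max b} then - monomial (l - m (Max b))
            else 0)
      else 0)"

definition min_resolution_supported_on_tree :: "('n, 'k::field) polynomial set \<Rightarrow> bool" where
  "min_resolution_supported_on_tree I \<longleftrightarrow>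
     (\<exists>r m E. min_mono_gens I r m \<and> tree {..<r} E \<and>
        min_free_resolution UNIV I (graph_basis r E) (graph_diff m))"

end

theory Submission
  imports Defs
begin

text \<open>
  Let \<open>m\<^sub>1, \<dots>, m\<^sub>r\<close> be the minimal generators of \<open>I\<close> and let \<open>Z\<close> be the module of their syzygies, the
  kernel of \<open>S\<^sup>r \<rightarrow> I\<close>. The complex of a graph with edge set \<open>E\<close> resolves \<open>S/I\<close> exactly when the
  syzygies \<open>\<sigma>\<^sub>i\<^sub>j = lcm(m\<^sub>i, m\<^sub>j)/m\<^sub>i \<sqdot> e\<^sub>i - lcm(m\<^sub>i, m\<^sub>j)/m\<^sub>j \<sqdot> e\<^sub>j\<close>, for the edges \<open>{i, j}\<close>, form a basis
  of \<open>Z\<close>. It is then minimal, because \<open>I\<close> is proper and no \<open>m\<^sub>i\<close> divides another one. So a tree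
  resolution, cut off at \<open>S\<close>, is a minimal resolution of \<open>I\<close> of length at most one, and the converse
  amounts to finding a tree whose edge syzygies are a basis of \<open>Z\<close>.

  The module \<open>Z\<close> is graded by exponents. In degree \<open>l\<close> it consists of the vectors with entries
  \<open>c\<^sub>k x\<^sup>l / m\<^sub>k\<close>, where \<open>m\<^sub>k\<close> divides \<open>x\<^sup>l\<close> and \<open>\<Sum>c\<^sub>k = 0\<close>; differences of two basis vectors span such
  coefficient vectors, so the \<open>\<sigma>\<^sub>i\<^sub>j\<close> for all pairs generate \<open>Z\<close>
  (\<open>syzygies_subset_edge_span_all_pairs\<close>). Let \<open>E\<close> be a smallest set of pairs that still generates.
  In a relation \<open>\<Sum>w\<^sub>x \<sigma>\<^sub>x = 0\<close> all constant terms vanish, because a nonzero one would allow to solve the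
  component in the degree of \<open>\<sigma>\<^sub>x\<close> for \<open>\<sigma>\<^sub>x\<close> (\<open>relation_constant_term_zero\<close>).

  This is where projective dimension enters. Comparing the generators \<open>m\<^sub>k\<close> with an arbitrary
  resolution \<open>0 \<rightarrow> F\<^sub>1 \<rightarrow> F\<^sub>0 \<rightarrow> I \<rightarrow> 0\<close> shows, as in Schanuel's lemma, that the surjection
  \<open>\<phi> : S\<^sup>E \<rightarrow> Z\<close> has a section \<open>s\<close> (\<open>syzygies_lift_splits\<close>). The projection \<open>\<pi> = 1 - s \<circ> \<phi>\<close> onto \<open>ker \<phi>\<close> has
  values in \<open>ker \<phi> \<subseteq> \<^bold>m S\<^sup>E\<close> and fixes \<open>ker \<phi>\<close>, hence \<open>ker \<phi> \<subseteq> \<^bold>m\<^sup>t S\<^sup>E\<close> implies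
  \<open>ker \<phi> \<subseteq> \<^bold>m\<^sup>t\<^sup>+\<^sup>1 S\<^sup>E\<close>. Therefore \<open>ker \<phi> = 0\<close> and the \<open>\<sigma>\<^sub>x\<close> for \<open>x \<in> E\<close> are a basis
  (\<open>relation_zero_if_split\<close>).

  A set of edges whose syzygies are a basis of \<open>Z\<close> is a tree. If \<open>i\<close> and \<open>j\<close> were in different
  components, then \<open>v \<mapsto> \<Sum>v\<^sub>k m\<^sub>k\<close>, summed over the component of \<open>i\<close>, would vanish on all edge
  syzygies but not on \<open>\<sigma>\<^sub>i\<^sub>j\<close> (\<open>spanning_edges_connected\<close>). If an edge \<open>{i, j}\<close> closed a cycle,
  then summing along the rest of the cycle would express a monomial multiple of \<open>\<sigma>\<^sub>i\<^sub>j\<close> by the other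
  edge syzygies (\<open>independent_edges_acyclic\<close>).
\<close>

section \<open>Exponents and monomials\<close>

abbreviation "lookup \<equiv> Poly_Mapping.lookup"
abbreviation "keys \<equiv> Poly_Mapping.keys"
abbreviation "single \<equiv> Poly_Mapping.single"

text \<open>Divisibility of monomials, unlike the lexicographic class order on finitely supported functions.\<close>

definition exp_le :: "'n exponent \<Rightarrow> 'n exponent \<Rightarrow> bool" (infix "\<preceq>" 50) where
  "a \<preceq> b \<longleftrightarrow> (\<forall>x. lookup a x \<le> lookup b x)"

lemma exp_le_refl [simp]: "a \<preceq> a"
  by (simp add: exp_le_def)

lemma exp_le_trans [trans]: "a \<preceq> b \<Longrightarrow> b \<preceq> c \<Longrightarrow> a \<preceq> c"
  unfolding exp_le_def by (meson order_trans)

lemma exp_le_add [simp]: "a \<preceq> a + b" "b \<preceq> a + b"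
  by (simp_all add: exp_le_def lookup_add)

lemma exp_diff_add [simp]: "a \<preceq> b \<Longrightarrow> b - a + a = b" "a \<preceq> b \<Longrightarrow> a + (b - a) = b"
  by (rule poly_mapping_eqI, simp add: exp_le_def lookup_add lookup_minus)+

lemma exp_diff_add_diff [simp]:
  "a \<preceq> b \<Longrightarrow> b \<preceq> c \<Longrightarrow> (c - b) + (b - a) = c - a"
  by (rule poly_mapping_eqI) (simp add: exp_le_def lookup_add lookup_minus)

lemma exp_diff_le_diff_iff:
  assumes "a \<preceq> b" "a \<preceq> c"
  shows "b - a \<preceq> c - a \<longleftrightarrow> b \<preceq> c"
proof -
  have "lookup b x - lookup a x \<le> lookup c x - lookup a x \<longleftrightarrow> lookup b x \<le> lookup c x" for x
    using assms by (simp add: exp_le_def le_diff_iff)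
  then show ?thesis by (simp add: exp_le_def lookup_minus)
qed

lemma exp_diff_diff_diff:
  assumes "a \<preceq> b" "b \<preceq> c"
  shows "c - a - (b - a) = c - b"
  using assms by (intro poly_mapping_eqI) (simp add: exp_le_def lookup_minus)

lemma lcm_exp_le_iff [simp]: "lcm_exp a b \<preceq> c \<longleftrightarrow> a \<preceq> c \<and> b \<preceq> c"
  by (auto simp: exp_le_def lcm_exp.rep_eq)

lemma exp_le_lcm [simp]: "a \<preceq> lcm_exp a b" "b \<preceq> lcm_exp a b"
  by (auto simp: exp_le_def lcm_exp.rep_eq)

lemma lcm_exp_commute: "lcm_exp a b = lcm_exp b a"
  by (rule poly_mapping_eqI) (simp add: lcm_exp.rep_eq max.commute)

lemma lcm_exp_diff_eq_0_iff: "lcm_exp a b - a = 0 \<longleftrightarrow> b \<preceq> a"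
proof -
  have "lcm_exp a b - a = 0 \<longleftrightarrow> (\<forall>x. lookup (lcm_exp a b - a) x = 0)"
    by (auto intro: poly_mapping_eqI)
  then show ?thesis by (simp add: exp_le_def lookup_minus lcm_exp.rep_eq)
qed

lemma monomial_mult: "monomial a * monomial b = monomial (a + b)"
  by (simp add: monomial_def mult_single)

lemma monomial_neq_0 [simp]: "monomial a \<noteq> (0 :: ('n, 'k::field) polynomial)"
  by (metis monomial_def lookup_single_eq lookup_zero zero_neq_one)

lemma lookup_single_mult:
  fixes p :: "('n, 'k::field) polynomial"
  shows "lookup (single a c * p) l = (if a \<preceq> l then c * lookup p (l - a) else 0)"
proof -
  have eq: "l = a + q \<longleftrightarrow> a \<preceq> l \<and> l - a = q" for q
    by auto
  have "lookup (single a c * p) l = (\<Sum>l'. (c when a = l') * (\<Sum>q. lookup p q when l = l' + q))"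
    by (simp add: lookup_mult lookup_single)
  also have "\<dots> = (\<Sum>l'. c * (\<Sum>q. lookup p q when l = l' + q) when a = l')"
    by (simp add: when_mult)
  also have "\<dots> = c * (\<Sum>q. lookup p q when l = a + q)"
    by simp
  also have "\<dots> = (if a \<preceq> l then c * lookup p (l - a) else 0)"
    by (simp add: eq)
  finally show ?thesis .
qed


section \<open>Ideals\<close>

interpretation ideal: module "(*) :: ('n, 'k::field) polynomial \<Rightarrow> _"
  by unfold_locales (simp_all add: algebra_simps)

text \<open>As a rewrite rule this reassociates products against the direction of \<open>mult.assoc\<close>.\<close>

declare ideal.scale_scale [simp del]

lemma ideal_gen_UNIV_iff_one: "ideal_gen A = UNIV \<longleftrightarrow> 1 \<in> ideal_gen A"
proof
  assume "1 \<in> ideal_gen A"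
  then have "p \<in> ideal_gen A" for p
    using ideal.span_scale[of 1 A p] by (simp add: ideal_gen_def)
  then show "ideal_gen A = UNIV" by blast
qed simp

lemma ideal_gen_finite_range:
  fixes g :: "'b \<Rightarrow> ('n, 'k::field) polynomial"
  assumes "finite B"
  shows "ideal_gen (g ` B) = range (\<lambda>v. \<Sum>b\<in>B. v b * g b)" (is "_ = range ?f")
proof -
  have "ideal.span (g ` B) \<subseteq> range ?f"
  proof (rule ideal.span_minimal)
    show "g ` B \<subseteq> range ?f"
    proof (rule image_subsetI)
      fix b assume "b \<in> B"
      then have "g b = ?f (\<lambda>c. if c = b then 1 else 0)"
        using assms by (simp add: if_distrib[of "\<lambda>t. t * _"] cong: if_cong)
      then show "g b \<in> range ?f" by (rule range_eqI[where f = ?f])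
    qed
    show "ideal.subspace (range ?f)"
    proof (rule ideal.subspaceI)
      show "0 \<in> range ?f" by (rule range_eqI[of _ _ "\<lambda>_. 0"]) simp
      fix x y c assume "x \<in> range ?f"
      then obtain v where v: "x = ?f v" by (rule rangeE)
      have "c * x = ?f (\<lambda>b. c * v b)"
        unfolding v by (simp add: sum_distrib_left mult.assoc)
      then show "c * x \<in> range ?f" by (rule range_eqI[where f = ?f])
      assume "y \<in> range ?f"
      then obtain w where w: "y = ?f w" by (rule rangeE)
      have "x + y = ?f (\<lambda>b. v b + w b)"
        unfolding v w by (simp add: sum.distrib distrib_right)
      then show "x + y \<in> range ?f" by (rule range_eqI[where f = ?f])
    qed
  qed
  moreover have "range ?f \<subseteq> ideal.span (g ` B)"
  proof (rule image_subsetI)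
    show "?f v \<in> ideal.span (g ` B)" for v
      by (rule ideal.span_sum) (blast intro: ideal.span_scale ideal.span_base)
  qed
  ultimately show ?thesis by (simp add: ideal_gen_def)
qed

lemma monomial_in_max_ideal:
  assumes "a \<noteq> 0"
  shows "(monomial a :: ('n, 'k::field) polynomial) \<in> max_ideal"
proof -
  obtain x where "lookup a x \<noteq> 0"
    using assms by (metis lookup_zero poly_mapping_eqI)
  then have "single x 1 \<preceq> a"
    by (auto simp: exp_le_def lookup_single when_def)
  then have "monomial a = monomial (a - single x 1) * (variable x :: ('n, 'k) polynomial)"
    by (simp add: variable_def monomial_mult)
  moreover have "(variable x :: ('n, 'k) polynomial) \<in> ideal.span (range variable)"
    by (intro ideal.span_base) simp
  ultimately have "monomial a \<in> ideal.span (range variable :: ('n, 'k) polynomial set)"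
    by (simp only: ideal.span_scale)
  then show ?thesis by (simp add: max_ideal_def ideal_gen_def)
qed

lemma max_ideal_closed:
  shows "0 \<in> max_ideal"
    and "p \<in> max_ideal \<Longrightarrow> - p \<in> max_ideal"
    and "p \<in> max_ideal \<Longrightarrow> p * q \<in> max_ideal"
    and "(\<And>i. i \<in> A \<Longrightarrow> f i \<in> max_ideal) \<Longrightarrow> sum f A \<in> max_ideal"
  unfolding max_ideal_def ideal_gen_def
  using ideal.span_scale[of p _ q]
  by (auto intro: ideal.span_zero ideal.span_neg ideal.span_sum simp: mult.commute)

lemma min_mono_gens_not_divides:
  fixes I :: "('n, 'k::field) polynomial set"
  assumes "min_mono_gens I r m" "i < r" "j < r" "i \<noteq> j"
  shows "\<not> m i \<preceq> m j"
proof
  assume le: "m i \<preceq> m j"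
  let ?A = "m ` {..<r}"
  have ne: "m i \<noteq> m j"
    using assms by (auto simp: min_mono_gens_def inj_on_def)
  have "(monomial (m j) :: ('n, 'k) polynomial) = monomial (m j - m i) * monomial (m i)"
    using le by (simp add: monomial_mult)
  also have "\<dots> \<in> ideal.span (monomial ` (?A - {m j}))"
    using assms ne by (intro ideal.span_scale ideal.span_base) auto
  finally have mj: "monomial (m j) \<in> ideal.span (monomial ` (?A - {m j}) :: ('n, 'k) polynomial set)" .
  have "monomial ` ?A \<subseteq> ideal.span (monomial ` (?A - {m j}) :: ('n, 'k) polynomial set)"
  proof (rule image_subsetI)
    fix a assume "a \<in> ?A"
    then show "monomial a \<in> ideal.span (monomial ` (?A - {m j}) :: ('n, 'k) polynomial set)"
      using mj by (cases "a = m j") (auto intro: ideal.span_base)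
  qed
  then have "ideal.span (monomial ` ?A) \<subseteq> ideal.span (monomial ` (?A - {m j}) :: ('n, 'k) polynomial set)"
    by (rule ideal.span_minimal) simp
  moreover have "ideal.span (monomial ` (?A - {m j})) \<subseteq> ideal.span (monomial ` ?A :: ('n, 'k) polynomial set)"
    by (rule ideal.span_mono) auto
  ultimately have "I = ideal_gen (monomial ` (?A - {m j}))"
    using assms unfolding min_mono_gens_def ideal_gen_def by blast
  moreover have "?A - {m j} \<subset> ?A" using assms by auto
  ultimately show False using assms unfolding min_mono_gens_def by blast
qed

text \<open>Finite generation by arbitrary polynomials suffices: each of them is a combination of finitely
  many of the given monomials.\<close>

lemma monomial_ideal_has_min_mono_gens:
  fixes I :: "('n, 'k::field) polynomial set"
  assumes "monomial_ideal I" and fg: "finite G" "I = ideal_gen G"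
  obtains r m where "min_mono_gens I r m"
proof -
  obtain A where A: "I = ideal_gen (monomial ` A)"
    using assms by (auto simp: monomial_ideal_def)
  have "\<exists>A'\<subseteq>A. finite A' \<and> g \<in> ideal_gen (monomial ` A')" if "g \<in> G" for g
  proof -
    have "g \<in> ideal.span (monomial ` A)"
      using that fg A by (metis ideal_gen_def ideal.span_base)
    then obtain T c where T: "finite T" "T \<subseteq> monomial ` A" "g = (\<Sum>t\<in>T. c t * t)"
      by (auto simp: ideal.span_explicit)
    then obtain A' where "A' \<subseteq> A" "finite A'" "T = monomial ` A'"
      by (meson finite_subset_image)
    moreover from this have "g \<in> ideal_gen (monomial ` A')"
      unfolding ideal_gen_def T(3) by (intro ideal.span_sum ideal.span_scale ideal.span_base) auto
    ultimately show ?thesis by blast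
  qed
  then obtain F where F: "\<And>g. g \<in> G \<Longrightarrow> F g \<subseteq> A \<and> finite (F g) \<and> g \<in> ideal_gen (monomial ` F g)"
    by metis
  let ?B = "\<Union>g\<in>G. F g"
  have finB: "finite ?B" using F fg by blast
  have "G \<subseteq> ideal.span (monomial ` ?B)"
  proof
    fix g assume g: "g \<in> G"
    have "ideal.span (monomial ` F g) \<subseteq> (ideal.span (monomial ` ?B) :: ('n, 'k) polynomial set)"
      using g by (intro ideal.span_mono) auto
    then show "g \<in> ideal.span (monomial ` ?B)"
      using F[OF g] by (auto simp: ideal_gen_def)
  qed
  then have "I \<subseteq> ideal_gen (monomial ` ?B)"
    unfolding fg ideal_gen_def by (rule ideal.span_minimal) simp
  moreover have "ideal_gen (monomial ` ?B) \<subseteq> I"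
    unfolding A ideal_gen_def by (rule ideal.span_mono) (use F in blast)
  ultimately have IB: "I = ideal_gen (monomial ` ?B)" by blast
  define P where "P = (\<lambda>C. finite C \<and> I = ideal_gen (monomial ` C))"
  have "\<exists>C. P C" using IB finB by (auto simp: P_def)
  then obtain C where C: "P C" and min: "\<And>C'. P C' \<Longrightarrow> card C \<le> card C'"
    using ex_has_least_nat[of P _ card] by blast
  obtain m where m: "bij_betw m {0..<card C} C"
    using C ex_bij_betw_nat_finite unfolding P_def by blast
  then have mC: "m ` {..<card C} = C" "inj_on m {..<card C}"
    by (auto simp: bij_betw_def atLeast0LessThan)
  have "I \<noteq> ideal_gen (monomial ` C')" if "C' \<subset> C" for C'
  proof
    assume "I = ideal_gen (monomial ` C')"
    then have "P C'" using that C by (auto simp: P_def intro: finite_subset)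
    then show False
      using min[of C'] psubset_card_mono[OF _ that] C by (auto simp: P_def)
  qed
  then have "min_mono_gens I (card C) m"
    using C mC by (auto simp: min_mono_gens_def P_def)
  then show thesis by (rule that)
qed


section \<open>Split syzygy modules\<close>

text \<open>Associativity of matrix products: all comparisons of maps between free modules below reduce
  to it, with vectors acting as rows from the left.\<close>

lemma sum_mult_assoc:
  fixes x :: "'i \<Rightarrow> 'r::comm_semiring_0"
  shows "(\<Sum>i\<in>A. (\<Sum>j\<in>B. x j * M j i) * y i) = (\<Sum>j\<in>B. x j * (\<Sum>i\<in>A. M j i * y i))"
  unfolding sum_distrib_left sum_distrib_right mult.assoc by (rule sum.swap)

text \<open>
  Two presentations of the same ideal are compared: the generators \<open>\<mu>\<close>, whose syzygies are generated
  by the \<open>\<sigma>\<close>, and the generators \<open>e\<close>, whose syzygies are free with the basis \<open>D\<close>. The result is a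
  section \<open>s\<close> of the surjection \<open>\<phi>\<close> from the free module on \<open>E\<close> to the syzygies of \<open>\<mu>\<close>, given by its
  values on the \<open>\<sigma>\<close>; that these values define a linear map is the last conclusion. Write \<open>\<alpha>\<close> and
  \<open>\<gamma>\<close> for lifts of the identity of the ideal in the two directions. A syzygy \<open>z\<close> of \<open>\<mu>\<close> is
  \<open>\<gamma>(\<alpha> z) + (z - \<gamma>(\<alpha> z))\<close>. The first summand has a preimage under \<open>\<phi>\<close> that is linear in \<open>z\<close>, because
  \<open>\<alpha> z\<close> has unique coordinates with respect to the basis \<open>D\<close>, and the second one because \<open>1 - \<gamma>\<alpha>\<close> is
  defined on the whole free module and takes values in the syzygies.
\<close>

lemma syzygies_lift_splits:
  fixes \<mu> :: "'a \<Rightarrow> 'r::comm_ring_1" and e :: "'b \<Rightarrow> 'r"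
    and D :: "'c \<Rightarrow> 'b \<Rightarrow> 'r" and \<sigma> :: "'e \<Rightarrow> 'a \<Rightarrow> 'r"
  assumes fin: "finite A"
    and \<mu>: "\<And>a. a \<in> A \<Longrightarrow> \<exists>u. \<mu> a = (\<Sum>b\<in>B. u b * e b)"
    and e: "\<And>b. b \<in> B \<Longrightarrow> \<exists>u. e b = (\<Sum>a\<in>A. u a * \<mu> a)"
    and exact: "\<And>v. (\<Sum>b\<in>B. v b * e b) = 0 \<Longrightarrow> \<exists>f. \<forall>b\<in>B. v b = (\<Sum>c\<in>C. f c * D c b)"
    and complex: "\<And>c. c \<in> C \<Longrightarrow> (\<Sum>b\<in>B. D c b * e b) = 0"
    and inj: "\<And>f. \<forall>b\<in>B. (\<Sum>c\<in>C. f c * D c b) = 0 \<Longrightarrow> \<forall>c\<in>C. f c = 0"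
    and syz: "\<And>x. x \<in> E \<Longrightarrow> (\<Sum>a\<in>A. \<sigma> x a * \<mu> a) = 0"
    and span: "\<And>z. (\<Sum>a\<in>A. z a * \<mu> a) = 0 \<Longrightarrow> \<exists>w. \<forall>a\<in>A. z a = (\<Sum>x\<in>E. w x * \<sigma> x a)"
  obtains s where "\<And>x a. x \<in> E \<Longrightarrow> a \<in> A \<Longrightarrow> (\<Sum>y\<in>E. s x y * \<sigma> y a) = \<sigma> x a"
    and "\<And>w y. \<forall>a\<in>A. (\<Sum>x\<in>E. w x * \<sigma> x a) = 0 \<Longrightarrow> (\<Sum>x\<in>E. w x * s x y) = 0"
proof -
  obtain \<alpha> where \<alpha>: "\<And>a. a \<in> A \<Longrightarrow> \<mu> a = (\<Sum>b\<in>B. \<alpha> a b * e b)"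
    using \<mu> by metis
  obtain \<gamma> where \<gamma>: "\<And>b. b \<in> B \<Longrightarrow> e b = (\<Sum>a\<in>A. \<gamma> b a * \<mu> a)"
    using e by metis
  \<comment> \<open>\<open>f x\<close> are the coordinates of \<open>\<alpha> (\<sigma> x)\<close> with respect to the basis \<open>D\<close>.\<close>
  define v where "v x b = (\<Sum>a\<in>A. \<sigma> x a * \<alpha> a b)" for x b
  have "(\<Sum>b\<in>B. v x b * e b) = 0" if "x \<in> E" for x
  proof -
    have "(\<Sum>b\<in>B. v x b * e b) = (\<Sum>a\<in>A. \<sigma> x a * (\<Sum>b\<in>B. \<alpha> a b * e b))"
      unfolding v_def by (rule sum_mult_assoc)
    also have "\<dots> = 0" using syz[OF that] by (simp add: \<alpha>)
    finally show ?thesis .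
  qed
  then have "\<forall>x\<in>E. \<exists>f. \<forall>b\<in>B. v x b = (\<Sum>c\<in>C. f c * D c b)"
    using exact by blast
  then obtain f where f: "\<And>x b. x \<in> E \<Longrightarrow> b \<in> B \<Longrightarrow> v x b = (\<Sum>c\<in>C. f x c * D c b)"
    by metis
  \<comment> \<open>\<open>\<psi> c\<close> is a preimage of \<open>\<gamma> (D c)\<close> under \<open>\<phi>\<close>.\<close>
  define y where "y c a = (\<Sum>b\<in>B. D c b * \<gamma> b a)" for c a
  have "(\<Sum>a\<in>A. y c a * \<mu> a) = 0" if "c \<in> C" for c
  proof -
    have "(\<Sum>a\<in>A. y c a * \<mu> a) = (\<Sum>b\<in>B. D c b * (\<Sum>a\<in>A. \<gamma> b a * \<mu> a))"
      unfolding y_def by (rule sum_mult_assoc)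
    also have "\<dots> = 0" using complex[OF that] by (simp add: \<gamma>)
    finally show ?thesis .
  qed
  then have "\<forall>c\<in>C. \<exists>w. \<forall>a\<in>A. y c a = (\<Sum>x\<in>E. w x * \<sigma> x a)"
    using span by blast
  then obtain \<psi> where \<psi>: "\<And>c a. c \<in> C \<Longrightarrow> a \<in> A \<Longrightarrow> y c a = (\<Sum>x\<in>E. \<psi> c x * \<sigma> x a)"
    by metis
  \<comment> \<open>\<open>h a\<close> is a preimage under \<open>\<phi>\<close> of the image \<open>d a\<close> of a basis vector under \<open>1 - \<gamma>\<alpha>\<close>.\<close>
  define d where "d a a' = (if a' = a then 1 else 0) - (\<Sum>b\<in>B. \<alpha> a b * \<gamma> b a')" for a a'
  have "(\<Sum>a'\<in>A. d a a' * \<mu> a') = 0" if "a \<in> A" for a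
  proof -
    have "(\<Sum>a'\<in>A. d a a' * \<mu> a') =
        (\<Sum>a'\<in>A. if a' = a then \<mu> a' else 0) - (\<Sum>a'\<in>A. (\<Sum>b\<in>B. \<alpha> a b * \<gamma> b a') * \<mu> a')"
      unfolding d_def left_diff_distrib sum_subtractf by (simp add: if_distrib[of "\<lambda>t. t * _"] cong: if_cong)
    also have "(\<Sum>a'\<in>A. if a' = a then \<mu> a' else 0) = \<mu> a"
      using fin that by simp
    also have "(\<Sum>a'\<in>A. (\<Sum>b\<in>B. \<alpha> a b * \<gamma> b a') * \<mu> a') = (\<Sum>b\<in>B. \<alpha> a b * (\<Sum>a'\<in>A. \<gamma> b a' * \<mu> a'))"
      by (rule sum_mult_assoc)
    also have "\<dots> = \<mu> a" using \<alpha>[OF that] by (simp add: \<gamma>)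
    finally show ?thesis by simp
  qed
  then have "\<forall>a\<in>A. \<exists>w. \<forall>a'\<in>A. d a a' = (\<Sum>x\<in>E. w x * \<sigma> x a')"
    using span by blast
  then obtain h where h: "\<And>a a'. a \<in> A \<Longrightarrow> a' \<in> A \<Longrightarrow> d a a' = (\<Sum>x\<in>E. h a x * \<sigma> x a')"
    by metis
  define s where "s x x' = (\<Sum>c\<in>C. f x c * \<psi> c x') + (\<Sum>a\<in>A. \<sigma> x a * h a x')" for x x'
  show thesis
  proof (rule that[of s])
    fix x a' assume x: "x \<in> E" and a': "a' \<in> A"
    have "(\<Sum>x'\<in>E. s x x' * \<sigma> x' a') =
        (\<Sum>x'\<in>E. (\<Sum>c\<in>C. f x c * \<psi> c x') * \<sigma> x' a') + (\<Sum>x'\<in>E. (\<Sum>a\<in>A. \<sigma> x a * h a x') * \<sigma> x' a')"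
      unfolding s_def distrib_right sum.distrib ..
    also have "\<dots> = (\<Sum>c\<in>C. f x c * y c a') + (\<Sum>a\<in>A. \<sigma> x a * d a a')"
      unfolding sum_mult_assoc by (simp add: \<psi> h a')
    also have "(\<Sum>c\<in>C. f x c * y c a') = (\<Sum>b\<in>B. v x b * \<gamma> b a')"
      unfolding y_def sum_mult_assoc[symmetric] using x by (simp add: f)
    also have "\<dots> = (\<Sum>a\<in>A. \<sigma> x a * (\<Sum>b\<in>B. \<alpha> a b * \<gamma> b a'))"
      unfolding v_def by (rule sum_mult_assoc)
    also have "(\<Sum>a\<in>A. \<sigma> x a * d a a') = \<sigma> x a' - (\<Sum>a\<in>A. \<sigma> x a * (\<Sum>b\<in>B. \<alpha> a b * \<gamma> b a'))"
      unfolding d_def right_diff_distrib sum_subtractf using fin a'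
      by (simp add: if_distrib[of "\<lambda>t. _ * t"] cong: if_cong)
    finally show "(\<Sum>x'\<in>E. s x x' * \<sigma> x' a') = \<sigma> x a'" by simp
  next
    fix w x' assume w: "\<forall>a\<in>A. (\<Sum>x\<in>E. w x * \<sigma> x a) = 0"
    have "(\<Sum>c\<in>C. (\<Sum>x\<in>E. w x * f x c) * D c b) = 0" if "b \<in> B" for b
    proof -
      have "(\<Sum>c\<in>C. (\<Sum>x\<in>E. w x * f x c) * D c b) = (\<Sum>x\<in>E. w x * v x b)"
        unfolding sum_mult_assoc using that by (simp add: f)
      also have "\<dots> = (\<Sum>a\<in>A. (\<Sum>x\<in>E. w x * \<sigma> x a) * \<alpha> a b)"
        unfolding v_def sum_mult_assoc ..
      also have "\<dots> = 0" using w by simp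
      finally show ?thesis .
    qed
    then have 0: "\<forall>c\<in>C. (\<Sum>x\<in>E. w x * f x c) = 0"
      by (intro inj) blast
    have "(\<Sum>x\<in>E. w x * s x x') =
        (\<Sum>c\<in>C. (\<Sum>x\<in>E. w x * f x c) * \<psi> c x') + (\<Sum>a\<in>A. (\<Sum>x\<in>E. w x * \<sigma> x a) * h a x')"
      unfolding s_def distrib_left sum.distrib sum_mult_assoc ..
    also have "\<dots> = 0" using 0 w by simp
    finally show "(\<Sum>x\<in>E. w x * s x x') = 0" .
  qed
qed


section \<open>Syzygies of monomials\<close>

text \<open>The entries from \<open>r\<close> on are zero, so that syzygies of \<open>r\<close> monomials are equal as functions
  when they agree on the indices below \<open>r\<close>.\<close>

definition syzygies :: "nat \<Rightarrow> (nat \<Rightarrow> 'n exponent) \<Rightarrow> (nat \<Rightarrow> ('n, 'k::field) polynomial) set" where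
  "syzygies r m = {z. (\<forall>k\<ge>r. z k = 0) \<and> (\<Sum>k<r. z k * monomial (m k)) = 0}"

text \<open>The syzygy \<open>x\<^sup>l/m\<^sub>i \<sqdot> e\<^sub>i - x\<^sup>l/m\<^sub>j \<sqdot> e\<^sub>j\<close> for a common multiple \<open>x\<^sup>l\<close> of \<open>m\<^sub>i\<close> and \<open>m\<^sub>j\<close>. Letting
  the degree \<open>l\<close> vary makes these vectors add up along paths, which the edge syzygies themselves,
  each in its own degree, do not.\<close>

definition binomial_syzygy ::
  "(nat \<Rightarrow> 'n exponent) \<Rightarrow> 'n exponent \<Rightarrow> nat \<Rightarrow> nat \<Rightarrow> nat \<Rightarrow> ('n, 'k::field) polynomial" where
  "binomial_syzygy m l i j k =
     (if k = i then monomial (l - m i) else 0) - (if k = j then monomial (l - m j) else 0)"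

abbreviation edge_syzygy ::
  "(nat \<Rightarrow> 'n exponent) \<Rightarrow> nat set \<Rightarrow> nat \<Rightarrow> ('n, 'k::field) polynomial" where
  "edge_syzygy m x k \<equiv> graph_diff m 2 {k} x"

definition edge_span ::
  "(nat \<Rightarrow> 'n exponent) \<Rightarrow> nat set set \<Rightarrow> (nat \<Rightarrow> ('n, 'k::field) polynomial) set" where
  "edge_span m E = range (\<lambda>w k. \<Sum>x\<in>E. w x * edge_syzygy m x k)"

lemma edge_syzygy_pair:
  assumes "i < j"
  shows "edge_syzygy m {i, j} k = binomial_syzygy m (lcm_exp (m i) (m j)) i j k"
  using assms by (auto simp: graph_diff_def binomial_syzygy_def Let_def)

lemma pair_cases:
  assumes "graph {..<r::nat} E" "x \<in> E"
  obtains i j where "x = {i, j}" "i < j" "j < r"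
proof -
  have "card x = 2" "x \<subseteq> {..<r}" using assms by (auto simp: graph_def)
  then obtain i j where ij: "x = {i, j}" "i \<noteq> j" by (auto simp: card_2_iff)
  show thesis
    by (cases "i < j") (use ij \<open>x \<subseteq> {..<r}\<close> that[of i j] that[of j i] in \<open>auto simp: insert_commute\<close>)
qed

lemma graph_finite: "graph {..<r::nat} E \<Longrightarrow> finite E"
  by (rule finite_subset[of _ "Pow {..<r}"]) (auto simp: graph_def)

text \<open>For the set of all indices this says that the vector is a syzygy; for a connected component it is
  the functional that detects missing paths.\<close>

lemma binomial_syzygy_weighted_sum:
  fixes m :: "nat \<Rightarrow> 'n exponent"
  assumes "finite C" "m i \<preceq> l" "m j \<preceq> l"
  shows "(\<Sum>k\<in>C. binomial_syzygy m l i j k * monomial (m k)) =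
    (if i \<in> C then monomial l else 0) - (if j \<in> C then monomial l else (0 :: ('n, 'k::field) polynomial))"
proof -
  have "(\<Sum>k\<in>C. binomial_syzygy m l i j k * monomial (m k)) =
    (\<Sum>k\<in>C. if k = i then monomial l else 0) - (\<Sum>k\<in>C. if k = j then monomial l else (0 :: ('n, 'k) polynomial))"
    unfolding binomial_syzygy_def left_diff_distrib sum_subtractf
    by (intro arg_cong2[where f = minus] sum.cong) (use assms in \<open>auto simp: monomial_mult\<close>)
  then show ?thesis using assms by simp
qed

lemma binomial_syzygy_in_syzygies:
  assumes "i < r" "j < r" "m i \<preceq> l" "m j \<preceq> l"
  shows "(binomial_syzygy m l i j :: nat \<Rightarrow> ('n, 'k::field) polynomial) \<in> syzygies r m"
proof -
  have "(binomial_syzygy m l i j k :: ('n, 'k::field) polynomial) = 0" if "k \<ge> r" for k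
    using that assms by (simp add: binomial_syzygy_def)
  then show ?thesis using assms by (simp add: syzygies_def binomial_syzygy_weighted_sum)
qed

lemma edge_syzygy_in_syzygies:
  assumes "graph {..<r} E" "x \<in> E"
  shows "(edge_syzygy m x :: nat \<Rightarrow> ('n, 'k::field) polynomial) \<in> syzygies r m"
proof -
  obtain i j where "x = {i, j}" "i < j" "j < r" using assms by (rule pair_cases)
  moreover from this have "(edge_syzygy m x :: nat \<Rightarrow> ('n, 'k::field) polynomial) =
      binomial_syzygy m (lcm_exp (m i) (m j)) i j"
    by (intro ext) (simp add: edge_syzygy_pair)
  ultimately show ?thesis by (simp add: binomial_syzygy_in_syzygies)
qed

lemma binomial_syzygy_trans:
  "binomial_syzygy m l i j n + binomial_syzygy m l j k n = binomial_syzygy m l i k n"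
  by (simp add: binomial_syzygy_def)

lemma binomial_syzygy_mult:
  assumes "m i \<preceq> l" "m j \<preceq> l" "l \<preceq> l'"
  shows "monomial (l' - l) * binomial_syzygy m l i j k = binomial_syzygy m l' i j k"
  using assms by (simp add: binomial_syzygy_def right_diff_distrib monomial_mult)


subsection \<open>Spans of edge syzygies\<close>

lemma edge_spanI:
  assumes "\<And>k. v k = (\<Sum>x\<in>E. w x * edge_syzygy m x k)"
  shows "v \<in> edge_span m E"
  unfolding edge_span_def using assms by (intro range_eqI[where x = w] ext)

lemma edge_spanE:
  assumes "v \<in> edge_span m E"
  obtains w where "v = (\<lambda>k. \<Sum>x\<in>E. w x * edge_syzygy m x k)"
  using assms unfolding edge_span_def by (rule rangeE)

lemma edge_span_zero: "(\<lambda>_. 0) \<in> edge_span m E"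
  by (rule edge_spanI[where w = "\<lambda>_. 0"]) simp

lemma edge_span_add:
  assumes "u \<in> edge_span m E" "v \<in> edge_span m E"
  shows "(\<lambda>k. u k + v k) \<in> edge_span m E"
proof -
  obtain w where "u = (\<lambda>k. \<Sum>x\<in>E. w x * edge_syzygy m x k)"
    using assms(1) by (rule edge_spanE)
  moreover obtain w' where "v = (\<lambda>k. \<Sum>x\<in>E. w' x * edge_syzygy m x k)"
    using assms(2) by (rule edge_spanE)
  ultimately have "u k + v k = (\<Sum>x\<in>E. (w x + w' x) * edge_syzygy m x k)" for k
    by (simp add: sum.distrib distrib_right)
  then show ?thesis by (rule edge_spanI)
qed

lemma edge_span_scale:
  assumes "v \<in> edge_span m E"
  shows "(\<lambda>k. c * v k) \<in> edge_span m E"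
proof -
  obtain w where "v = (\<lambda>k. \<Sum>x\<in>E. w x * edge_syzygy m x k)"
    using assms by (rule edge_spanE)
  then have "c * v k = (\<Sum>x\<in>E. (c * w x) * edge_syzygy m x k)" for k
    by (simp add: sum_distrib_left mult.assoc)
  then show ?thesis by (rule edge_spanI)
qed

lemma edge_span_sum:
  assumes "\<And>a. a \<in> A \<Longrightarrow> v a \<in> edge_span m E"
  shows "(\<lambda>k. \<Sum>a\<in>A. v a k) \<in> edge_span m E"
  using assms
proof (induction A rule: infinite_finite_induct)
  case (insert a A)
  then show ?case using edge_span_add[of "v a" m E "\<lambda>k. \<Sum>a\<in>A. v a k"] by simp
qed (simp_all add: edge_span_zero)

lemma edge_span_base:
  assumes "finite E" "x \<in> E"
  shows "edge_syzygy m x \<in> edge_span m E"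
  using assms
  by (intro edge_spanI[where w = "\<lambda>y. if y = x then 1 else 0"])
    (simp add: if_distrib[of "\<lambda>t. t * _"] cong: if_cong)

lemma edge_span_minimal:
  fixes m :: "nat \<Rightarrow> 'n exponent"
  assumes "\<And>x. x \<in> E \<Longrightarrow>
    (edge_syzygy m x :: nat \<Rightarrow> ('n, 'k::field) polynomial) \<in> edge_span m E'"
  shows "edge_span m E \<subseteq> (edge_span m E' :: (nat \<Rightarrow> ('n, 'k) polynomial) set)"
proof
  fix v :: "nat \<Rightarrow> ('n, 'k) polynomial"
  assume "v \<in> edge_span m E"
  then obtain w where "v = (\<lambda>k. \<Sum>x\<in>E. w x * edge_syzygy m x k)" by (rule edge_spanE)
  then show "v \<in> edge_span m E'"
    using assms by (auto intro!: edge_span_sum edge_span_scale)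
qed

lemma binomial_syzygy_same: "binomial_syzygy m l i i = (\<lambda>_. 0)"
  by (simp add: binomial_syzygy_def fun_eq_iff)

lemma binomial_syzygy_swap: "binomial_syzygy m l i j = (\<lambda>k. (- 1) * binomial_syzygy m l j i k)"
  by (simp add: binomial_syzygy_def fun_eq_iff)

lemma binomial_syzygy_in_edge_span:
  assumes "finite E" "{i, j} \<in> E" "m i \<preceq> l" "m j \<preceq> l"
  shows "binomial_syzygy m l i j \<in> edge_span m E"
  using assms(2-)
proof (induction i j rule: linorder_wlog)
  case (le i j)
  show ?case
  proof (cases "i = j")
    case True
    then show ?thesis by (simp add: binomial_syzygy_same edge_span_zero)
  next
    case False
    let ?l = "lcm_exp (m i) (m j)"
    have "(\<lambda>k. monomial (l - ?l) * edge_syzygy m {i, j} k) \<in> edge_span m E"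
      using assms(1) le by (intro edge_span_scale edge_span_base)
    then show ?thesis using le False by (simp add: edge_syzygy_pair binomial_syzygy_mult)
  qed
next
  case (sym j i)
  then show ?case
    by (subst binomial_syzygy_swap) (intro edge_span_scale, simp add: insert_commute)
qed

lemma path_syzygy_in_edge_span:
  fixes m :: "nat \<Rightarrow> 'n exponent"
  assumes "finite E" and le: "\<And>x k. x \<in> E \<Longrightarrow> k \<in> x \<Longrightarrow> m k \<preceq> l"
    and "(i, j) \<in> {(x, y). {x, y} \<in> E}\<^sup>*"
  shows "(binomial_syzygy m l i j :: nat \<Rightarrow> ('n, 'k::field) polynomial) \<in> edge_span m E"
  using assms(3)
proof (induction rule: rtrancl_induct)
  case base
  show ?case by (simp add: binomial_syzygy_same edge_span_zero)
next
  case (step j k)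
  then have jk: "{j, k} \<in> E" by simp
  have "(binomial_syzygy m l j k :: nat \<Rightarrow> ('n, 'k) polynomial) \<in> edge_span m E"
    using assms(1) le[OF jk] jk by (intro binomial_syzygy_in_edge_span) auto
  with step.IH have "(\<lambda>n. binomial_syzygy m l i j n + binomial_syzygy m l j k n :: ('n, 'k) polynomial) \<in> edge_span m E"
    by (rule edge_span_add)
  then show ?case by (simp add: binomial_syzygy_trans)
qed

lemma all_pairs_graph: "graph V {x. x \<subseteq> V \<and> card x = 2}"
  by (simp add: graph_def)

lemma lookup_mult_monomial:
  fixes p :: "('n, 'k::field) polynomial"
  shows "lookup (p * monomial a) l = (if a \<preceq> l then lookup p (l - a) else 0)"
  using lookup_single_mult[of a 1 p l] by (simp add: monomial_def mult.commute)

text \<open>A syzygy is the sum of its homogeneous components. The component in degree \<open>l\<close> has the entries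
  \<open>c\<^sub>k x\<^sup>l/m\<^sub>k\<close> with \<open>\<Sum>c\<^sub>k = 0\<close>; fixing one index \<open>i\<close> with \<open>m\<^sub>i\<close> dividing \<open>x\<^sup>l\<close>, it equals the sum over \<open>k\<close> of
  \<open>c\<^sub>k\<close> times the binomial syzygy of \<open>k\<close> and \<open>i\<close>, since the coefficients at \<open>e\<^sub>i\<close> cancel.\<close>

lemma syzygies_subset_edge_span_all_pairs:
  fixes m :: "nat \<Rightarrow> 'n exponent"
  shows "syzygies r m \<subseteq> (edge_span m {x. x \<subseteq> {..<r} \<and> card x = 2} ::
    (nat \<Rightarrow> ('n, 'k::field) polynomial) set)" (is "_ \<subseteq> edge_span m ?P")
proof
  fix z :: "nat \<Rightarrow> ('n, 'k) polynomial"
  assume "z \<in> syzygies r m"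
  then have out: "\<And>k. k \<ge> r \<Longrightarrow> z k = 0" and rel: "(\<Sum>k<r. z k * monomial (m k)) = 0"
    by (auto simp: syzygies_def)
  have finP: "finite ?P" by (rule graph_finite[OF all_pairs_graph])
  define c where "c l k = (if m k \<preceq> l then lookup (z k) (l - m k) else 0)" for l k
  define part where "part l k = single (l - m k) (c l k)" for l k
  define L where "L = (\<Union>k<r. (\<lambda>a. m k + a) ` keys (z k))"
  have finL: "finite L" by (simp add: L_def)
  have zero_sum: "(\<Sum>k<r. c l k) = 0" for l
    using arg_cong[OF rel, of "\<lambda>p. lookup p l"]
    by (simp add: lookup_sum lookup_mult_monomial c_def)
  have part_span: "part l \<in> edge_span m ?P" for l
  proof (cases "\<exists>i<r. m i \<preceq> l")
    case True
    then obtain i where i: "i < r" "m i \<preceq> l" by blast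
    have "(\<lambda>n. \<Sum>k<r. single 0 (c l k) * binomial_syzygy m l k i n) \<in> edge_span m ?P"
    proof (rule edge_span_sum)
      fix k assume k: "k \<in> {..<r}"
      show "(\<lambda>n. single 0 (c l k) * binomial_syzygy m l k i n) \<in> edge_span m ?P"
      proof (cases "m k \<preceq> l \<and> k \<noteq> i")
        case True
        then have "binomial_syzygy m l k i \<in> edge_span m ?P"
          using finP i k by (intro binomial_syzygy_in_edge_span) auto
        then show ?thesis by (rule edge_span_scale)
      next
        case False
        then have "single 0 (c l k) * binomial_syzygy m l k i n = 0" for n
          by (auto simp: c_def binomial_syzygy_def)
        then show ?thesis by (simp add: edge_span_zero)
      qed
    qed
    moreover have "part l n = (\<Sum>k<r. single 0 (c l k) * binomial_syzygy m l k i n)" for n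
    proof -
      have "(\<Sum>k<r. single 0 (c l k) * binomial_syzygy m l k i n) =
          (\<Sum>k<r. if k = n then single (l - m n) (c l n) else 0)
          - (\<Sum>k<r. if n = i then single (l - m i) (c l k) else 0)"
        unfolding binomial_syzygy_def right_diff_distrib sum_subtractf
        by (intro arg_cong2[where f = minus] sum.cong) (auto simp: monomial_def mult_single)
      also have "(\<Sum>k<r. if n = i then single (l - m i) (c l k) else 0) = 0"
      proof (rule poly_mapping_eqI)
        fix b
        have "lookup (\<Sum>k<r. single (l - m i) (c l k)) b = ((\<Sum>k<r. c l k) when l - m i = b)"
          by (simp add: lookup_sum lookup_single when_def)
        then show "lookup (\<Sum>k<r. if n = i then single (l - m i) (c l k) else 0) b = lookup 0 b"
          by (cases "n = i") (simp_all add: zero_sum)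
      qed
      also have "(\<Sum>k<r. if k = n then single (l - m n) (c l n) else 0) = part l n"
        using out[of n] by (auto simp: part_def c_def)
      finally show ?thesis by simp
    qed
    ultimately show ?thesis by presburger
  next
    case False
    then have "part l k = 0" for k
      using out[of k] by (cases "k < r") (auto simp: part_def c_def)
    then have "part l = (\<lambda>_. 0)" by (simp add: fun_eq_iff)
    then show ?thesis by (simp add: edge_span_zero)
  qed
  have "z k = (\<Sum>l\<in>L. part l k)" for k
  proof (rule poly_mapping_eqI)
    fix b
    have "lookup (\<Sum>l\<in>L. part l k) b = (\<Sum>l\<in>L. if l = m k + b then lookup (z k) b else 0)"
      unfolding lookup_sum
    proof (rule sum.cong)
      fix l
      have "m k \<preceq> l \<and> l - m k = b \<longleftrightarrow> l = m k + b" by auto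
      then show "lookup (part l k) b = (if l = m k + b then lookup (z k) b else 0)"
        by (auto simp: part_def c_def lookup_single when_def)
    qed simp
    also have "\<dots> = lookup (z k) b"
    proof (cases "m k + b \<in> L")
      case False
      then have "\<not> k < r \<or> b \<notin> keys (z k)" by (auto simp: L_def)
      then have "lookup (z k) b = 0" using out[of k] by (auto simp: in_keys_iff)
      then show ?thesis by (simp add: sum.neutral)
    qed (use finL in simp)
    finally show "lookup (z k) b = lookup (\<Sum>l\<in>L. part l k) b" ..
  qed
  moreover have "(\<lambda>k. \<Sum>l\<in>L. part l k) \<in> edge_span m ?P"
    by (intro edge_span_sum part_span)
  ultimately show "z \<in> edge_span m ?P" by presburger
qed


section \<open>Minimal spanning sets of edges\<close>

abbreviation edge_label :: "(nat \<Rightarrow> 'n exponent) \<Rightarrow> nat set \<Rightarrow> 'n exponent" where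
  "edge_label m x \<equiv> lcm_exp (m (Min x)) (m (Max x))"

lemma edge_syzygy_eq_single:
  "edge_syzygy m x k = single (edge_label m x - m k)
     (if k = Min x then 1 else if k = Max x then - 1 else 0)"
  by (auto simp: graph_diff_def Let_def monomial_def single_uminus)

text \<open>Nakayama's lemma in graded form. The relation is homogenized: keeping from each \<open>w x\<close> only the term
  that contributes to the degree \<open>l\<close> of the syzygy of \<open>x0\<close> gives another relation, in which the
  coefficient of \<open>x0\<close> is the constant term of \<open>w x0\<close>. If that is a unit of the field, the syzygy of
  \<open>x0\<close> is redundant.\<close>

lemma relation_constant_term_zero:
  fixes m :: "nat \<Rightarrow> 'n exponent" and w :: "nat set \<Rightarrow> ('n, 'k::field) polynomial"
  assumes "finite E" "x0 \<in> E"
    and irredundant: "(edge_syzygy m x0 :: nat \<Rightarrow> ('n, 'k) polynomial) \<notin> edge_span m (E - {x0})"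
    and rel: "\<And>k. (\<Sum>x\<in>E. w x * edge_syzygy m x k) = 0"
  shows "lookup (w x0) 0 = 0"
proof (rule ccontr)
  assume nz: "lookup (w x0) 0 \<noteq> 0"
  define l where "l = edge_label m x0"
  define c where "c x = (if edge_label m x \<preceq> l then lookup (w x) (l - edge_label m x) else 0)" for x
  define part where "part x = single (l - edge_label m x) (c x)" for x
  define s :: "nat set \<Rightarrow> nat \<Rightarrow> 'k"
    where "s x k = (if k = Min x then 1 else if k = Max x then - 1 else 0)" for x k
  have syz: "edge_syzygy m x k = single (edge_label m x - m k) (s x k)" for x k
    by (simp add: edge_syzygy_eq_single s_def)
  have s_le: "m k \<preceq> edge_label m x" if "s x k \<noteq> 0" for x k
    using that by (auto simp: s_def simp del: lcm_exp_le_iff split: if_splits)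
  have part_rel: "(\<Sum>x\<in>E. part x * edge_syzygy m x k) = 0" for k
  proof (cases "m k \<preceq> l")
    case True
    \<comment> \<open>Reading off \<open>rel\<close> at the exponent \<open>l - m k\<close> leaves a relation between scalars.\<close>
    have coeff: "lookup (w x * edge_syzygy m x k) (l - m k) = c x * s x k" for x
    proof (cases "s x k = 0")
      case False
      then have "m k \<preceq> edge_label m x" by (rule s_le)
      then show ?thesis
        unfolding syz using True
        by (simp add: mult.commute[of "w x"] lookup_single_mult c_def exp_diff_le_diff_iff
            exp_diff_diff_diff del: lcm_exp_le_iff)
    qed (simp add: syz)
    have part_mult: "part x * edge_syzygy m x k = single (l - m k) (c x * s x k)" for x
    proof (cases "s x k = 0 \<or> c x = 0")
      case False
      then have "m k \<preceq> edge_label m x" "edge_label m x \<preceq> l"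
        using s_le by (auto simp: c_def simp del: lcm_exp_le_iff split: if_splits)
      then show ?thesis by (simp add: part_def syz mult_single del: lcm_exp_le_iff)
    qed (auto simp: part_def syz)
    have "(\<Sum>x\<in>E. c x * s x k) = lookup (\<Sum>x\<in>E. w x * edge_syzygy m x k) (l - m k)"
      unfolding lookup_sum coeff ..
    then have "(\<Sum>x\<in>E. c x * s x k) = 0" by (simp add: rel)
    moreover have "(\<Sum>x\<in>E. part x * edge_syzygy m x k) = single (l - m k) (\<Sum>x\<in>E. c x * s x k)"
      unfolding part_mult by (rule poly_mapping_eqI) (simp add: lookup_sum lookup_single when_def)
    ultimately show ?thesis by simp
  next
    case False
    have "part x * edge_syzygy m x k = 0" for x
    proof (cases "s x k = 0")
      case False
      then have "m k \<preceq> edge_label m x" by (rule s_le)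
      with \<open>\<not> m k \<preceq> l\<close> have "\<not> edge_label m x \<preceq> l" using exp_le_trans by blast
      then show ?thesis by (simp add: part_def c_def del: lcm_exp_le_iff)
    qed (simp add: syz)
    then show ?thesis by simp
  qed
  have part0: "part x0 = single 0 (lookup (w x0) 0)"
    by (simp add: part_def c_def l_def del: lcm_exp_le_iff)
  let ?q = "single 0 (- inverse (lookup (w x0) 0)) :: ('n, 'k) polynomial"
  have "(\<lambda>k. ?q * (\<Sum>x\<in>E - {x0}. part x * edge_syzygy m x k)) \<in> edge_span m (E - {x0})"
    using assms(1) by (intro edge_span_scale edge_span_sum edge_span_base) auto
  moreover have "edge_syzygy m x0 k = ?q * (\<Sum>x\<in>E - {x0}. part x * edge_syzygy m x k)" for k
  proof -
    have "(\<Sum>x\<in>E - {x0}. part x * edge_syzygy m x k) = - (part x0 * edge_syzygy m x0 k)"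
      using part_rel[of k] assms(1,2) by (simp add: sum.remove eq_neg_iff_add_eq_0 add.commute)
    then have "?q * (\<Sum>x\<in>E - {x0}. part x * edge_syzygy m x k)
        = - (?q * part x0) * edge_syzygy m x0 k"
      by (simp add: mult.assoc)
    also have "?q * part x0 = - 1"
      using nz by (simp add: part0 mult_single single_uminus)
    finally show ?thesis by simp
  qed
  ultimately show False using irredundant by presburger
qed

lemma minimal_spanning_edges:
  fixes m :: "nat \<Rightarrow> 'n exponent"
  obtains E where "graph {..<r} E"
    and "syzygies r m \<subseteq> (edge_span m E :: (nat \<Rightarrow> ('n, 'k::field) polynomial) set)"
    and "\<And>x. x \<in> E \<Longrightarrow> (edge_syzygy m x :: nat \<Rightarrow> ('n, 'k) polynomial) \<notin> edge_span m (E - {x})"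
proof -
  define P where "P E \<longleftrightarrow> graph {..<r} E \<and>
    syzygies r m \<subseteq> (edge_span m E :: (nat \<Rightarrow> ('n, 'k::field) polynomial) set)" for E
  have "P {x. x \<subseteq> {..<r} \<and> card x = 2}"
    unfolding P_def using all_pairs_graph syzygies_subset_edge_span_all_pairs by blast
  then obtain E where E: "P E" and min: "\<And>E'. P E' \<Longrightarrow> card E \<le> card E'"
    using ex_has_least_nat[of P _ card] by blast
  have fin: "finite E" using E graph_finite by (auto simp: P_def)
  show thesis
  proof (rule that)
    fix x assume x: "x \<in> E"
    show "(edge_syzygy m x :: nat \<Rightarrow> ('n, 'k) polynomial) \<notin> edge_span m (E - {x})"
    proof
      assume red: "(edge_syzygy m x :: nat \<Rightarrow> ('n, 'k) polynomial) \<in> edge_span m (E - {x})"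
      have "edge_span m E \<subseteq> (edge_span m (E - {x}) :: (nat \<Rightarrow> ('n, 'k) polynomial) set)"
      proof (rule edge_span_minimal)
        fix y assume "y \<in> E"
        then show "(edge_syzygy m y :: nat \<Rightarrow> ('n, 'k) polynomial) \<in> edge_span m (E - {x})"
          using red fin by (cases "y = x") (auto intro: edge_span_base)
      qed
      then have "P (E - {x})" using E by (auto simp: P_def graph_def)
      then have "card E \<le> card (E - {x})" by (rule min)
      then show False using card_Diff1_less[OF fin x] by simp
    qed
  qed (use E in \<open>auto simp: P_def\<close>)
qed

text \<open>Relations form the kernel \<open>K\<close> of the map \<open>\<phi>\<close> with \<open>\<phi> \<epsilon>\<^sub>x = \<sigma> x\<close> on basis vectors, and \<open>u x = \<epsilon>\<^sub>x - s x\<close> lies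
  in \<open>K\<close>. A relation satisfies \<open>w = \<Sum>w\<^sub>x u x\<close>, because \<open>\<Sum>w\<^sub>x s x\<close> is the value of the section at \<open>\<phi> w = 0\<close>. As the entries of each \<open>u x\<close> have no constant term, a
  lower bound on the degrees of the terms that occur in relations can always be raised by one.\<close>

lemma relation_zero_if_split:
  fixes \<sigma> :: "'e \<Rightarrow> 'a \<Rightarrow> ('n::finite, 'k::field) polynomial"
  assumes fin: "finite E"
    and const: "\<And>w x. \<forall>a\<in>A. (\<Sum>x\<in>E. w x * \<sigma> x a) = 0 \<Longrightarrow> x \<in> E \<Longrightarrow> lookup (w x) 0 = 0"
    and lift: "\<And>x a. x \<in> E \<Longrightarrow> a \<in> A \<Longrightarrow> (\<Sum>y\<in>E. s x y * \<sigma> y a) = \<sigma> x a"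
    and kill: "\<And>w y. \<forall>a\<in>A. (\<Sum>x\<in>E. w x * \<sigma> x a) = 0 \<Longrightarrow> (\<Sum>x\<in>E. w x * s x y) = 0"
    and rel: "\<forall>a\<in>A. (\<Sum>x\<in>E. w x * \<sigma> x a) = 0" and x: "x \<in> E"
  shows "w x = 0"
proof -
  define deg :: "'n exponent \<Rightarrow> nat" where "deg a = (\<Sum>i\<in>UNIV. lookup a i)" for a
  have deg_add: "deg (a + b) = deg a + deg b" for a b
    by (simp add: deg_def lookup_add sum.distrib)
  have deg_0: "deg a = 0 \<longleftrightarrow> a = 0" for a
    by (auto simp: deg_def intro: poly_mapping_eqI)
  define u where "u x y = (if x = y then 1 else 0) - s x y" for x y
  have u0: "lookup (u x y) 0 = 0" if "x \<in> E" "y \<in> E" for x y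
  proof (rule const[OF _ \<open>y \<in> E\<close>], intro ballI)
    fix a assume a: "a \<in> A"
    have "(\<Sum>y\<in>E. u x y * \<sigma> y a) = (\<Sum>y\<in>E. if x = y then \<sigma> y a else 0) - (\<Sum>y\<in>E. s x y * \<sigma> y a)"
      unfolding u_def left_diff_distrib sum_subtractf
      by (simp add: if_distrib[of "\<lambda>t. t * _"] cong: if_cong)
    then show "(\<Sum>y\<in>E. u x y * \<sigma> y a) = 0"
      using lift[OF that(1) a] that fin by simp
  qed
  have decomp: "w y = (\<Sum>x\<in>E. w x * u x y)" if "y \<in> E" for y
  proof -
    have "(\<Sum>x\<in>E. w x * u x y) = (\<Sum>x\<in>E. if x = y then w x else 0) - (\<Sum>x\<in>E. w x * s x y)"
      unfolding u_def right_diff_distrib sum_subtractf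
      by (simp add: if_distrib[of "\<lambda>t. _ * t"] cong: if_cong)
    then show ?thesis using kill[OF rel] that fin by simp
  qed
  have "\<forall>y\<in>E. \<forall>a. deg a < t \<longrightarrow> lookup (w y) a = 0" for t
  proof (induction t)
    case (Suc t)
    show ?case
    proof (intro ballI allI impI)
      fix y a assume y: "y \<in> E" and a: "deg a < Suc t"
      have "lookup (w x * u x y) a = 0" if "x \<in> E" for x
      proof (rule ccontr)
        assume "lookup (w x * u x y) a \<noteq> 0"
        then have "a \<in> keys (w x * u x y)" by (simp add: in_keys_iff)
        then obtain b c where bc: "a = b + c" "b \<in> keys (w x)" "c \<in> keys (u x y)"
          using keys_mult[of "w x" "u x y"] by (auto dest!: subsetD)
        then have "\<not> deg b < t" using Suc that by (auto simp: in_keys_iff)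
        moreover have "deg c \<noteq> 0"
          using bc u0[OF that y] by (auto simp: deg_0 in_keys_iff)
        ultimately show False using a bc(1) by (simp add: deg_add)
      qed
      then show "lookup (w y) a = 0"
        by (subst decomp[OF y]) (simp add: lookup_sum)
    qed
  qed simp
  then show ?thesis
    using x by (intro poly_mapping_eqI) (metis lessI lookup_zero)
qed


section \<open>Trees\<close>

text \<open>The functional \<open>v \<mapsto> \<Sum>v\<^sub>k m\<^sub>k\<close>, summed over the component \<open>C\<close> of \<open>i\<close>, kills the syzygy of every edge,
  as an edge has both ends or no end in \<open>C\<close>, but sends the syzygy of \<open>i\<close> and \<open>j\<close> to a monomial if \<open>j\<close>
  is not in \<open>C\<close>.\<close>

lemma spanning_edges_connected:
  fixes m :: "nat \<Rightarrow> 'n exponent"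
  assumes graph: "graph {..<r} E"
    and span: "syzygies r m \<subseteq> (edge_span m E :: (nat \<Rightarrow> ('n, 'k::field) polynomial) set)"
  shows "connected_graph {..<r} E"
  unfolding connected_graph_def
proof (intro ballI, rule ccontr)
  fix i j assume ij: "i \<in> {..<r}" "j \<in> {..<r}"
  let ?R = "{(x, y). {x, y} \<in> E}"
  assume no: "(i, j) \<notin> ?R\<^sup>*"
  define C where "C = {k. k < r \<and> (i, k) \<in> ?R\<^sup>*}"
  have finC: "finite C" by (simp add: C_def)
  let ?l = "lcm_exp (m i) (m j)"
  have "binomial_syzygy m ?l i j \<in> (edge_span m E :: (nat \<Rightarrow> ('n, 'k) polynomial) set)"
    using ij binomial_syzygy_in_syzygies[of i r j m ?l] span by auto
  then obtain w :: "nat set \<Rightarrow> ('n, 'k) polynomial"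
    where w: "binomial_syzygy m ?l i j = (\<lambda>k. \<Sum>x\<in>E. w x * edge_syzygy m x k)"
    by (rule edge_spanE)
  have edge: "(\<Sum>k\<in>C. edge_syzygy m x k * monomial (m k)) = (0 :: ('n, 'k) polynomial)"
    if xE: "x \<in> E" for x
  proof -
    obtain a b where x: "x = {a, b}" "a < b" "b < r"
      using graph xE by (rule pair_cases)
    then have "(a, b) \<in> ?R" "(b, a) \<in> ?R" using xE by (auto simp: insert_commute)
    then have "(i, a) \<in> ?R\<^sup>* \<longleftrightarrow> (i, b) \<in> ?R\<^sup>*" by (meson rtrancl.rtrancl_into_rtrancl)
    then have "a \<in> C \<longleftrightarrow> b \<in> C" using x by (simp add: C_def)
    then show ?thesis
      using x finC by (simp add: edge_syzygy_pair binomial_syzygy_weighted_sum)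
  qed
  have "(\<Sum>k\<in>C. binomial_syzygy m ?l i j k * monomial (m k))
      = (\<Sum>x\<in>E. w x * (\<Sum>k\<in>C. edge_syzygy m x k * monomial (m k)))"
    unfolding w by (rule sum_mult_assoc)
  also have "\<dots> = 0" by (simp add: edge)
  finally have "(\<Sum>k\<in>C. binomial_syzygy m ?l i j k * monomial (m k)) = (0 :: ('n, 'k) polynomial)" .
  moreover have "i \<in> C" "j \<notin> C" using ij no by (auto simp: C_def)
  ultimately show False using finC by (simp add: binomial_syzygy_weighted_sum)
qed

text \<open>A cycle has at least three vertices, which are distinct; this keeps its closing edge from
  occurring a second time.\<close>

lemma cycle_detour:
  assumes "cycle E p"
  shows "(hd p, last p) \<in> {(x, y). {x, y} \<in> E - {{last p, hd p}}}\<^sup>*" (is "_ \<in> ?R\<^sup>*")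
proof -
  have len: "length p \<ge> 3" and dist: "distinct p"
    and steps: "\<And>i. i + 1 < length p \<Longrightarrow> {p ! i, p ! (i + 1)} \<in> E"
    using assms by (auto simp: cycle_def)
  have ends: "hd p = p ! 0" "last p = p ! (length p - 1)"
    using len by (cases "p = []"; simp add: hd_conv_nth last_conv_nth)+
  have "n < length p \<Longrightarrow> (p ! 0, p ! n) \<in> ?R\<^sup>*" for n
  proof (induction n)
    case (Suc n)
    have "p ! n = p ! 0 \<longleftrightarrow> n = 0"
      by (rule nth_eq_iff_index_eq[OF dist]) (use Suc.prems in auto)
    then have "{p ! n, p ! (n + 1)} \<noteq> {last p, hd p}"
      using Suc.prems len dist unfolding ends doubleton_eq_iff
      by (auto simp: nth_eq_iff_index_eq)
    then have "(p ! n, p ! Suc n) \<in> ?R" using steps[of n] Suc.prems by simp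
    then show ?case using Suc by (meson Suc_lessD rtrancl.rtrancl_into_rtrancl)
  qed simp
  from this[of "length p - 1"] show ?thesis using len unfolding ends by simp
qed

text \<open>In the degree of a common multiple of all labels, the binomial syzygy of the two ends of the
  closing edge is a multiple of the syzygy of that edge, and also a combination of the syzygies along
  the rest of the cycle. Independence then forces it to be zero.\<close>

lemma independent_edges_acyclic:
  fixes m :: "nat \<Rightarrow> 'n exponent"
  assumes graph: "graph {..<r} E"
    and indep: "\<And>(w :: nat set \<Rightarrow> ('n, 'k::field) polynomial) x.
      (\<And>k. (\<Sum>x\<in>E. w x * edge_syzygy m x k) = 0) \<Longrightarrow> x \<in> E \<Longrightarrow> w x = 0"
  shows "\<nexists>p. cycle E p"
proof
  assume "\<exists>p. cycle E p"
  then obtain p where p: "cycle E p" by blast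
  define i j where "i = hd p" and "j = last p"
  let ?x = "{i, j}"
  have x: "?x \<in> E" using p by (simp add: cycle_def i_def j_def insert_commute)
  have path: "(i, j) \<in> {(x, y). {x, y} \<in> E - {?x}}\<^sup>*"
    using cycle_detour[OF p] by (simp add: i_def j_def insert_commute)
  have fin: "finite E" using graph by (rule graph_finite)
  have ne: "i \<noteq> j"
    using p by (cases p) (auto simp: cycle_def i_def j_def)
  \<comment> \<open>The product of all labels serves as a common multiple.\<close>
  define l where "l = (\<Sum>k<r. m k)"
  have le: "m k \<preceq> l" if "y \<in> E" "k \<in> y" for y k
  proof -
    have "k < r" using graph that by (auto simp: graph_def)
    then show ?thesis by (simp add: l_def sum.remove[of _ k])
  qed
  have "binomial_syzygy m l i j \<in> (edge_span m (E - {?x}) :: (nat \<Rightarrow> ('n, 'k) polynomial) set)"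
    by (rule path_syzygy_in_edge_span[OF _ _ path]) (use fin le in auto)
  then obtain w :: "nat set \<Rightarrow> ('n, 'k) polynomial"
    where w: "binomial_syzygy m l i j = (\<lambda>k. \<Sum>x\<in>E - {?x}. w x * edge_syzygy m x k)"
    by (rule edge_spanE)
  have "binomial_syzygy m l i j \<in> (edge_span m {?x} :: (nat \<Rightarrow> ('n, 'k) polynomial) set)"
    using le[OF x] by (intro binomial_syzygy_in_edge_span) auto
  then obtain u :: "nat set \<Rightarrow> ('n, 'k) polynomial"
    where u: "binomial_syzygy m l i j = (\<lambda>k. \<Sum>x\<in>{?x}. u x * edge_syzygy m x k)"
    by (rule edge_spanE)
  let ?v = "w(?x := - u ?x)"
  have "(\<Sum>y\<in>E. ?v y * edge_syzygy m y k) = 0" for k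
  proof -
    have "(\<Sum>y\<in>E. ?v y * edge_syzygy m y k)
        = - (u ?x * edge_syzygy m ?x k) + (\<Sum>y\<in>E - {?x}. ?v y * edge_syzygy m y k)"
      by (subst sum.remove[OF fin x]) simp
    also have "(\<Sum>y\<in>E - {?x}. ?v y * edge_syzygy m y k) = (\<Sum>y\<in>E - {?x}. w y * edge_syzygy m y k)"
      by (intro sum.cong) auto
    also have "\<dots> = u ?x * edge_syzygy m ?x k"
      using fun_cong[OF w, of k] fun_cong[OF u, of k] by simp
    finally show ?thesis by simp
  qed
  then have "?v ?x = 0" using x by (rule indep)
  then have "binomial_syzygy m l i j i = (0 :: ('n, 'k) polynomial)"
    using fun_cong[OF u, of i] by simp
  then show False using ne by (simp add: binomial_syzygy_def)
qed


section \<open>The complex of a labelled graph\<close>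

lemma differential_free:
  "i \<ge> 1 \<Longrightarrow> v' = differential B D i v \<Longrightarrow> v' \<in> free_module (B (i - 1))"
  by (auto simp: differential_def free_module_def)

definition restrict_vec :: "'b set \<Rightarrow> ('b \<Rightarrow> ('n, 'k::field) polynomial) \<Rightarrow> 'b \<Rightarrow> ('n, 'k) polynomial" where
  "restrict_vec A v = (\<lambda>b. if b \<in> A then v b else 0)"

lemma restrict_vec_free [simp]: "restrict_vec A v \<in> free_module A"
  by (simp add: restrict_vec_def free_module_def)

lemma restrict_vec_in [simp]: "b \<in> A \<Longrightarrow> restrict_vec A v b = v b"
  by (simp add: restrict_vec_def)

lemma differential_restrict [simp]: "differential B D i (restrict_vec (B i) v) = differential B D i v"
  by (auto simp: differential_def fun_eq_iff intro!: sum.cong)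

text \<open>Since a differential reads only the entries of its argument that belong to the basis, its image
  may be computed with arbitrary vectors; this removes the membership in the free module from all
  exactness statements.\<close>

lemma image_differential: "differential B D i ` free_module (B i) = range (differential B D i)"
proof (intro equalityI subsetI)
  fix u assume "u \<in> range (differential B D i)"
  then obtain v where "u = differential B D i v" by (rule rangeE)
  then have "u = differential B D i (restrict_vec (B i) v)" by simp
  then show "u \<in> differential B D i ` free_module (B i)"
    using restrict_vec_free by (rule image_eqI)
qed auto

lemma differential_empty: "B i = {} \<Longrightarrow> differential B D i v = (\<lambda>_. 0)"
  by (simp add: differential_def fun_eq_iff)

lemma graph_basis_simps [simp]:
  "graph_basis r E 0 = {{}}"
  "graph_basis r E (Suc 0) = (\<lambda>k. {k}) ` {..<r}"
  "graph_basis r E 2 = E"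
  "i \<ge> 3 \<Longrightarrow> graph_basis r E i = {}"
  by (auto simp: graph_basis_def)

lemma singleton_in_image_iff [simp]: "{k} \<in> (\<lambda>k. {k}) ` A \<longleftrightarrow> k \<in> A"
  by auto

lemma graph_differential_1:
  "differential (graph_basis r E) (graph_diff m) (Suc 0) v =
     (\<lambda>a. if a = {} then \<Sum>k<r. v {k} * monomial (m k) else 0)"
  by (auto simp: differential_def graph_diff_def sum.reindex inj_on_def mult.commute)

lemma graph_differential_2:
  "differential (graph_basis r E) (graph_diff m) 2 v =
     (\<lambda>a. if a \<in> (\<lambda>k. {k}) ` {..<r} then \<Sum>x\<in>E. v x * graph_diff m 2 a x else 0)"
  by (simp add: differential_def mult.commute fun_eq_iff)

lemma edge_syzygy_outside:
  assumes "graph {..<r} E" "x \<in> E" "\<not> k < r"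
  shows "edge_syzygy m x k = (0 :: ('n, 'k::field) polynomial)"
  using edge_syzygy_in_syzygies[OF assms(1,2), of m, where 'k = 'k] assms(3) by (simp add: syzygies_def)

text \<open>The entries are \<open>lcm(m\<^sub>i, m\<^sub>j)/m\<^sub>i\<close> up to sign, and such a quotient is \<open>1\<close> only if \<open>m\<^sub>j\<close> divides \<open>m\<^sub>i\<close>.\<close>

lemma edge_syzygy_in_max_ideal:
  fixes I :: "('n, 'k::field) polynomial set"
  assumes "graph {..<r} E" "min_mono_gens I r m" "x \<in> E"
  shows "(edge_syzygy m x k :: ('n, 'k) polynomial) \<in> max_ideal"
proof -
  obtain i j where x: "x = {i, j}" "i < j" "j < r" using assms(1,3) by (rule pair_cases)
  have nd: "\<not> m i \<preceq> m j" "\<not> m j \<preceq> m i"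
    using min_mono_gens_not_divides[OF assms(2)] x by (metis less_trans nat_neq_iff)+
  then have "lcm_exp (m i) (m j) - m i \<noteq> 0" "lcm_exp (m i) (m j) - m j \<noteq> 0"
    using lcm_exp_diff_eq_0_iff[of "m i" "m j"] lcm_exp_diff_eq_0_iff[of "m j" "m i"]
    by (simp_all add: lcm_exp_commute)
  then show ?thesis
    using x by (auto simp: edge_syzygy_pair binomial_syzygy_def
        intro: monomial_in_max_ideal max_ideal_closed)
qed

text \<open>Exactness in degree one says that the edge syzygies generate, in degree two that they are
  independent. Minimality concerns the entries of the two differentials: the generators are not \<open>1\<close>
  because \<open>I\<close> is proper, and the entries of the edge syzygies are not \<open>1\<close> because the generators are
  minimal.\<close>

lemma graph_complex_min_resolution:
  fixes I :: "('n, 'k::field) polynomial set"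
  assumes graph: "graph {..<r} E" and gens: "min_mono_gens I r m" and proper: "I \<noteq> UNIV"
    and span: "syzygies r m \<subseteq> (edge_span m E :: (nat \<Rightarrow> ('n, 'k) polynomial) set)"
    and indep: "\<And>(w :: nat set \<Rightarrow> ('n, 'k) polynomial) x.
      (\<And>k. (\<Sum>x\<in>E. w x * edge_syzygy m x k) = 0) \<Longrightarrow> x \<in> E \<Longrightarrow> w x = 0"
  shows "min_free_resolution UNIV I (graph_basis r E) (graph_diff m)"
proof -
  let ?B = "graph_basis r E"
  let ?d = "differential (graph_basis r E) (graph_diff m) ::
    nat \<Rightarrow> (nat set \<Rightarrow> ('n, 'k) polynomial) \<Rightarrow> _"
  have fin: "finite (?B i)" for i
    using graph_finite[OF graph] by (simp add: graph_basis_def)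
  have I_eq: "I = range (\<lambda>v. \<Sum>k<r. v k * monomial (m k))"
    using gens ideal_gen_finite_range[of "{..<r}" "\<lambda>k. monomial (m k)"]
    by (simp add: min_mono_gens_def image_image)
  have I_d1: "p \<in> I \<longleftrightarrow> (\<exists>v. p = (\<Sum>k<r. v {k} * monomial (m k)))" for p
  proof
    assume "p \<in> I"
    then obtain v where "p = (\<Sum>k<r. v k * monomial (m k))" unfolding I_eq by (rule rangeE)
    then show "\<exists>v. p = (\<Sum>k<r. v {k} * monomial (m k))"
      by (intro exI[of _ "\<lambda>a. v (the_elem a)"]) simp
  next
    assume "\<exists>v. p = (\<Sum>k<r. v {k} * monomial (m k))"
    then show "p \<in> I" unfolding I_eq by (auto intro: range_eqI[where x = "\<lambda>k. _ {k}"])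
  qed
  have ker0: "{v \<in> free_module (?B 0). (\<Sum>b\<in>?B 0. v b * 1) \<in> I} = range (?d 1)"
  proof (intro set_eqI iffI)
    fix v assume v: "v \<in> {v \<in> free_module (?B 0). (\<Sum>b\<in>?B 0. v b * 1) \<in> I}"
    then obtain u where "v {} = (\<Sum>k<r. u {k} * monomial (m k))" using I_d1 by auto
    then have "v = ?d 1 u" using v by (auto simp: graph_differential_1 free_module_def fun_eq_iff)
    then show "v \<in> range (?d 1)" by (rule range_eqI[where f = "?d 1"])
  next
    fix v assume "v \<in> range (?d 1)"
    then obtain u where "v = ?d 1 u" by (rule rangeE)
    then show "v \<in> {v \<in> free_module (?B 0). (\<Sum>b\<in>?B 0. v b * 1) \<in> I}"
      using I_d1 by (auto simp: graph_differential_1 free_module_def)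
  qed
  have d1_zero: "?d 1 v = (\<lambda>_. 0) \<longleftrightarrow> (\<Sum>k<r. v {k} * monomial (m k)) = 0" for v
    by (auto simp: graph_differential_1 fun_eq_iff)
  have ker1: "{v \<in> free_module (?B 1). ?d 1 v = (\<lambda>_. 0)} = range (?d 2)"
  proof (intro set_eqI iffI)
    fix v assume "v \<in> {v \<in> free_module (?B 1). ?d 1 v = (\<lambda>_. 0)}"
    then have v: "v \<in> free_module (?B 1)" "(\<Sum>k<r. v {k} * monomial (m k)) = 0"
      by (simp_all only: mem_Collect_eq d1_zero)
    have "v {k} = 0" if "k \<ge> r" for k
    proof -
      have "{k} \<notin> ?B 1" using that by auto
      with v(1) show ?thesis unfolding free_module_def by blast
    qed
    with v(2) have "(\<lambda>k. v {k}) \<in> syzygies r m" by (simp add: syzygies_def)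
    then obtain w where w: "(\<lambda>k. v {k}) = (\<lambda>k. \<Sum>x\<in>E. w x * edge_syzygy m x k)"
      using span by (blast elim: edge_spanE)
    have "v = ?d 2 w"
      using v(1) fun_cong[OF w] by (auto simp: graph_differential_2 free_module_def fun_eq_iff)
    then show "v \<in> range (?d 2)" by (rule range_eqI[where f = "?d 2"])
  next
    fix v assume "v \<in> range (?d 2)"
    then obtain w where w: "v = ?d 2 w" by (rule rangeE)
    have "(\<Sum>k<r. v {k} * monomial (m k)) = (\<Sum>k<r. (\<Sum>x\<in>E. w x * edge_syzygy m x k) * monomial (m k))"
      by (simp add: w graph_differential_2)
    also have "\<dots> = (\<Sum>x\<in>E. w x * (\<Sum>k<r. edge_syzygy m x k * monomial (m k)))"
      by (rule sum_mult_assoc)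
    also have "\<dots> = 0"
      using edge_syzygy_in_syzygies[OF graph, of _ m, where 'k = 'k] by (intro sum.neutral) (auto simp: syzygies_def)
    finally show "v \<in> {v \<in> free_module (?B 1). ?d 1 v = (\<lambda>_. 0)}"
      using differential_free[of 2 v ?B "graph_diff m" w] w d1_zero[of v] by simp
  qed
  have ker2: "{v \<in> free_module (?B 2). ?d 2 v = (\<lambda>_. 0)} = {\<lambda>_. 0}"
  proof -
    have "w = (\<lambda>_. 0)" if w: "w \<in> free_module E" "?d 2 w = (\<lambda>_. 0)" for w
    proof -
      have "(\<Sum>x\<in>E. w x * edge_syzygy m x k) = 0" for k
        using fun_cong[OF w(2), of "{k}"] edge_syzygy_outside[OF graph, of _ k m, where 'k = 'k]
        by (cases "k < r") (auto simp: graph_differential_2)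
      then have "w x = 0" if "x \<in> E" for x using that by (rule indep)
      then show ?thesis using w(1) by (auto simp: free_module_def fun_eq_iff)
    qed
    then show ?thesis by (auto simp: free_module_def graph_differential_2)
  qed
  have exact: "{v \<in> free_module (?B i). ?d i v = (\<lambda>_. 0)} = range (?d (i + 1))" if i: "i \<ge> 1" for i
  proof -
    consider "i = 1" | "i = 2" | "i \<ge> 3" using i by linarith
    then show ?thesis
    proof cases
      case 2
      have "?d 3 v = (\<lambda>_. 0)" for v by (rule differential_empty) simp
      then show ?thesis using ker2 2 by auto
    next
      case 3
      have "?d i v = (\<lambda>_. 0)" "?d (i + 1) v = (\<lambda>_. 0)" for v
        using 3 by (auto intro!: differential_empty)
      then show ?thesis using 3 by (auto simp: free_module_def)
    qed (use ker1 in \<open>simp add: numeral_2_eq_2\<close>)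
  qed
  have res: "free_resolution UNIV I ?B (graph_diff m)"
    unfolding free_resolution_def image_differential
  proof (intro conjI allI impI exI[of _ "\<lambda>_. 1"] fin ker0 exact)
    have "\<exists>v y. p = (\<Sum>b\<in>?B 0. v b * 1) + y \<and> v \<in> free_module (?B 0) \<and> y \<in> I" for p
      by (intro exI[of _ "restrict_vec {{}} (\<lambda>_. p)"] exI[of _ 0])
        (use gens in \<open>simp add: min_mono_gens_def ideal_gen_def ideal.span_zero\<close>)
    then show "{(\<Sum>b\<in>?B 0. v b * 1) + y |v y. v \<in> free_module (?B 0) \<and> y \<in> I} = UNIV"
      by blast
  qed simp
  have "m k \<noteq> 0" if "k < r" for k
  proof
    assume "m k = 0"
    then have "monomial (m k) = (1 :: ('n, 'k) polynomial)" by (simp add: monomial_def)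
    then have "1 \<in> ideal_gen (monomial ` m ` {..<r} :: ('n, 'k) polynomial set)"
      using that by (auto simp: ideal_gen_def intro!: ideal.span_base image_eqI[of _ _ "m k"])
    then show False
      using gens proper ideal_gen_UNIV_iff_one unfolding min_mono_gens_def by metis
  qed
  then have "v * monomial (m k) \<in> max_ideal" if "k < r" for k and v :: "('n, 'k) polynomial"
    using that by (subst mult.commute) (intro max_ideal_closed(3) monomial_in_max_ideal)
  then have max1: "?d 1 v a \<in> max_ideal" for v a
    by (auto simp: graph_differential_1 intro!: max_ideal_closed(1,4))
  have max2: "?d 2 v a \<in> max_ideal" for v a
  proof -
    have "graph_diff m 2 {k} x * v x \<in> max_ideal" if "x \<in> E" for x k
      using edge_syzygy_in_max_ideal[OF graph gens that] by (rule max_ideal_closed(3))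
    then show ?thesis
      by (auto simp: graph_differential_2 mult.commute intro!: max_ideal_closed(1,4))
  qed
  have "?d (i + 1) v a \<in> max_ideal" for i v a
  proof -
    consider "i = 0" | "i = 1" | "i \<ge> 2" by linarith
    then show ?thesis
    proof cases
      case 3
      have "?d (i + 1) v = (\<lambda>_. 0)" using 3 by (intro differential_empty) simp
      then show ?thesis by (simp add: max_ideal_closed(1))
    qed (use max1[of v a] max2[of v a] in \<open>simp_all add: numeral_2_eq_2\<close>)
  qed
  then show ?thesis
    unfolding min_free_resolution_def image_differential
    using res differential_free[where i = "i + 1" for i, OF _ refl] by (auto simp: free_module_def differential_def)
qed


section \<open>From a resolution of length one to a tree\<close>

lemma free_resolution_splits_syzygies:
  fixes I :: "('n, 'k::field) polynomial set" and B :: "nat \<Rightarrow> 'b set"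
  assumes graph: "graph {..<r} E" and I: "I = ideal_gen (monomial ` m ` {..<r})"
    and span: "syzygies r m \<subseteq> (edge_span m E :: (nat \<Rightarrow> ('n, 'k) polynomial) set)"
    and res: "free_resolution I {0} B D" and short: "B 2 = {}"
  obtains s :: "nat set \<Rightarrow> nat set \<Rightarrow> ('n, 'k) polynomial"
    where "\<And>x k. x \<in> E \<Longrightarrow> k \<in> {..<r} \<Longrightarrow> (\<Sum>y\<in>E. s x y * edge_syzygy m y k) = edge_syzygy m x k"
    and "\<And>w y. \<forall>k\<in>{..<r}. (\<Sum>x\<in>E. w x * edge_syzygy m x k) = 0 \<Longrightarrow> (\<Sum>x\<in>E. w x * s x y) = 0"
proof -
  let ?d = "differential B D"
  obtain e where eI: "e ` B 0 \<subseteq> I"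
    and onto: "{(\<Sum>b\<in>B 0. v b * e b) + y |v y. v \<in> free_module (B 0) \<and> y \<in> {0}} = I"
    and ker: "{v \<in> free_module (B 0). (\<Sum>b\<in>B 0. v b * e b) \<in> {0}} = range (?d 1)"
    and fin: "\<And>i. finite (B i)"
    and inj: "{v \<in> free_module (B 1). ?d 1 v = (\<lambda>_. 0)} = range (?d (1 + 1))"
    using res unfolding free_resolution_def image_differential by blast
  have I_eq: "I = range (\<lambda>v. \<Sum>k<r. v k * monomial (m k))"
    unfolding I using ideal_gen_finite_range[of "{..<r}" "\<lambda>k. monomial (m k)"] by (simp add: image_image)
  have d2: "?d (1 + 1) v = (\<lambda>_. 0)" for v
    using short by (intro differential_empty) (simp add: numeral_2_eq_2)
  have d1: "?d 1 v b = (\<Sum>c\<in>B 1. v c * D 1 b c)" if "b \<in> B 0" for v b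
    using that by (simp add: differential_def mult.commute)
  show thesis
  proof (rule syzygies_lift_splits[where A = "{..<r}" and \<mu> = "\<lambda>k. monomial (m k)"
        and B = "B 0" and e = e and C = "B 1" and D = "\<lambda>c b. D 1 b c" and E = E
        and \<sigma> = "edge_syzygy m"])
    show "finite {..<r}" by simp
    show "\<exists>u. monomial (m k) = (\<Sum>b\<in>B 0. u b * e b)" if "k \<in> {..<r}" for k
    proof -
      have "monomial (m k) \<in> I"
        unfolding I ideal_gen_def using that by (intro ideal.span_base) auto
      then show ?thesis unfolding onto[symmetric] by auto
    qed
    show "\<exists>u. e b = (\<Sum>k<r. u k * monomial (m k))" if "b \<in> B 0" for b
    proof -
      have "e b \<in> I" using that eI by blast
      then obtain u where "e b = (\<Sum>k<r. u k * monomial (m k))" unfolding I_eq by (rule rangeE)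
      then show ?thesis by (rule exI[of _ u])
    qed
    show "\<exists>f. \<forall>b\<in>B 0. v b = (\<Sum>c\<in>B 1. f c * D 1 b c)" if "(\<Sum>b\<in>B 0. v b * e b) = 0" for v
    proof -
      have "restrict_vec (B 0) v \<in> {v \<in> free_module (B 0). (\<Sum>b\<in>B 0. v b * e b) \<in> {0}}"
        using that by (simp cong: sum.cong)
      then obtain f where f: "restrict_vec (B 0) v = ?d 1 f" unfolding ker by (rule rangeE)
      have "v b = (\<Sum>c\<in>B 1. f c * D 1 b c)" if "b \<in> B 0" for b
        using fun_cong[OF f, of b] that d1[OF that] by simp
      then show ?thesis by blast
    qed
    show "(\<Sum>b\<in>B 0. D 1 b c * e b) = 0" if c: "c \<in> B 1" for c
    proof -
      let ?u = "\<lambda>c'. if c' = c then 1 else 0"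
      have "?d 1 ?u b = D 1 b c" if "b \<in> B 0" for b
        using c fin[of 1] d1[OF that] by (simp add: if_distrib[of "\<lambda>t. t * _"] cong: if_cong)
      moreover have "?d 1 ?u \<in> {v \<in> free_module (B 0). (\<Sum>b\<in>B 0. v b * e b) \<in> {0}}"
        unfolding ker by (rule rangeI)
      ultimately show ?thesis by (simp cong: sum.cong)
    qed
    show "\<forall>c\<in>B 1. f c = 0" if "\<forall>b\<in>B 0. (\<Sum>c\<in>B 1. f c * D 1 b c) = 0" for f
    proof -
      have "?d 1 f = (\<lambda>_. 0)"
        using that by (auto simp: differential_def mult.commute)
      then have "restrict_vec (B 1) f \<in> {v \<in> free_module (B 1). ?d 1 v = (\<lambda>_. 0)}" by simp
      then have "restrict_vec (B 1) f = (\<lambda>_. 0)" unfolding inj d2 by simp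
      then show ?thesis by (metis restrict_vec_in)
    qed
    show "(\<Sum>k<r. edge_syzygy m x k * monomial (m k)) = (0 :: ('n, 'k) polynomial)" if "x \<in> E" for x
      using edge_syzygy_in_syzygies[OF graph that, of m, where 'k = 'k] by (simp add: syzygies_def)
    show "\<exists>w. \<forall>k\<in>{..<r}. z k = (\<Sum>x\<in>E. w x * edge_syzygy m x k)"
      if "(\<Sum>k<r. z k * monomial (m k)) = 0" for z :: "nat \<Rightarrow> ('n, 'k) polynomial"
    proof -
      have "restrict_vec {..<r} z \<in> syzygies r m"
        using that by (simp add: syzygies_def restrict_vec_def)
      then obtain w where w: "restrict_vec {..<r} z = (\<lambda>k. \<Sum>x\<in>E. w x * edge_syzygy m x k)"
        using span by (blast elim: edge_spanE)
      have "z k = (\<Sum>x\<in>E. w x * edge_syzygy m x k)" if "k \<in> {..<r}" for k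
        using fun_cong[OF w, of k] that by simp
      then show ?thesis by blast
    qed
  qed (rule that)
qed

text \<open>The given resolution enters through the splitting, which turns the irredundance of \<open>E\<close> into linear
  independence of its syzygies.\<close>

lemma short_resolution_imp_tree:
  fixes I :: "('n::finite, 'k::field) polynomial set" and B :: "nat \<Rightarrow> 'b set"
  assumes mono: "monomial_ideal I" and proper: "I \<noteq> UNIV"
    and res: "free_resolution I {0} B D" and short: "B 2 = {}"
  shows "min_resolution_supported_on_tree I"
proof -
  obtain e where e: "e ` B 0 \<subseteq> I"
      "{(\<Sum>b\<in>B 0. v b * e b) + y |v y. v \<in> free_module (B 0) \<and> y \<in> {0}} = I"
    and fin: "finite (B 0)"
    using res unfolding free_resolution_def
    by (elim conjE exE) (rule that, (assumption | erule spec)+)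
  have "ideal_gen (e ` B 0) = I"
  proof
    obtain A where "I = ideal.span A" using mono by (auto simp: monomial_ideal_def ideal_gen_def)
    then show "ideal_gen (e ` B 0) \<subseteq> I"
      unfolding ideal_gen_def using e(1) by (intro ideal.span_minimal) auto
    show "I \<subseteq> ideal_gen (e ` B 0)"
      using e(2) unfolding ideal_gen_finite_range[OF fin] by auto
  qed
  then obtain r m where gens: "min_mono_gens I r m"
    by (rule monomial_ideal_has_min_mono_gens[OF mono finite_imageI[OF fin] sym])
  obtain E where graph: "graph {..<r} E"
    and span: "syzygies r m \<subseteq> (edge_span m E :: (nat \<Rightarrow> ('n, 'k) polynomial) set)"
    and irredundant: "\<And>x. x \<in> E \<Longrightarrow>
      (edge_syzygy m x :: nat \<Rightarrow> ('n, 'k) polynomial) \<notin> edge_span m (E - {x})"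
    using minimal_spanning_edges[of r m] by blast
  have finE: "finite E" using graph by (rule graph_finite)
  have all: "(\<Sum>x\<in>E. w x * edge_syzygy m x k) = 0"
    if "\<forall>k\<in>{..<r}. (\<Sum>x\<in>E. w x * edge_syzygy m x k) = 0" for w :: "nat set \<Rightarrow> ('n, 'k) polynomial" and k
    using that edge_syzygy_outside[OF graph, of _ k m, where 'k = 'k] by (cases "k < r") auto
  obtain s :: "nat set \<Rightarrow> nat set \<Rightarrow> ('n, 'k) polynomial"
    where s: "\<And>x k. x \<in> E \<Longrightarrow> k \<in> {..<r} \<Longrightarrow>
        (\<Sum>y\<in>E. s x y * edge_syzygy m y k) = edge_syzygy m x k"
      "\<And>w y. \<forall>k\<in>{..<r}. (\<Sum>x\<in>E. w x * edge_syzygy m x k) = 0 \<Longrightarrow>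
        (\<Sum>x\<in>E. w x * s x y) = 0"
    using free_resolution_splits_syzygies[OF graph _ span res short] gens
    unfolding min_mono_gens_def by blast
  have indep: "w x = 0"
    if rel: "\<And>k. (\<Sum>x\<in>E. w x * edge_syzygy m x k) = 0" and x: "x \<in> E"
    for w :: "nat set \<Rightarrow> ('n, 'k) polynomial" and x
  proof (rule relation_zero_if_split[where A = "{..<r}" and \<sigma> = "edge_syzygy m" and s = s, OF finE _ s _ x])
    show "lookup (w x) 0 = 0"
      if "\<forall>k\<in>{..<r}. (\<Sum>x\<in>E. w x * edge_syzygy m x k) = 0" "x \<in> E"
      for w :: "nat set \<Rightarrow> ('n, 'k) polynomial" and x
      using finE that(2) irredundant[OF that(2)] all[OF that(1)]
      by (rule relation_constant_term_zero)
  qed (use rel in auto)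
  have "\<nexists>p. cycle E p"
    by (rule independent_edges_acyclic[where 'k = 'k and m = m, OF graph]) (fact indep)
  then have "tree {..<r} E"
    unfolding tree_def using graph spanning_edges_connected[OF graph span] by blast
  moreover have "min_free_resolution UNIV I (graph_basis r E) (graph_diff m)"
    by (rule graph_complex_min_resolution[OF graph gens proper span]) (fact indep)
  ultimately show ?thesis
    unfolding min_resolution_supported_on_tree_def using gens by blast
qed


section \<open>From a tree to a resolution of length one\<close>

lemma graph_complex_resolution_exact:
  fixes I :: "('n, 'k::field) polynomial set"
  assumes graph: "graph {..<r} E"
    and res: "free_resolution UNIV I (graph_basis r E) (graph_diff m)"
  shows "syzygies r m \<subseteq> (edge_span m E :: (nat \<Rightarrow> ('n, 'k) polynomial) set)"
    and "\<And>(w :: nat set \<Rightarrow> ('n, 'k) polynomial) x.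
      (\<And>k. (\<Sum>x\<in>E. w x * edge_syzygy m x k) = 0) \<Longrightarrow> x \<in> E \<Longrightarrow> w x = 0"
proof -
  let ?B = "graph_basis r E"
  let ?d = "differential (graph_basis r E) (graph_diff m) ::
    nat \<Rightarrow> (nat set \<Rightarrow> ('n, 'k) polynomial) \<Rightarrow> _"
  have exact: "{v \<in> free_module (?B i). ?d i v = (\<lambda>_. 0)} = range (?d (i + 1))" if "i \<ge> 1" for i
    using res[unfolded free_resolution_def image_differential] that by (elim conjE) (erule allE, erule mp)
  show "syzygies r m \<subseteq> (edge_span m E :: (nat \<Rightarrow> ('n, 'k) polynomial) set)"
  proof
    fix z :: "nat \<Rightarrow> ('n, 'k) polynomial"
    assume z: "z \<in> syzygies r m"
    define v where "v = restrict_vec ((\<lambda>k. {k}) ` {..<r}) (\<lambda>a. z (the_elem a))"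
    have vz: "v {k} = z k" for k
      using z by (cases "k < r") (auto simp: v_def restrict_vec_def syzygies_def)
    have "?d 1 v = (\<lambda>_. 0)"
      using z by (auto simp: graph_differential_1 vz syzygies_def)
    moreover have "v \<in> free_module (?B 1)" by (simp add: v_def)
    ultimately have "v \<in> range (?d 2)"
      using exact[of 1] by (auto simp: numeral_2_eq_2)
    then obtain w where w: "v = ?d 2 w" by (rule rangeE)
    have "z = restrict_vec {..<r} (\<lambda>k. \<Sum>x\<in>E. w x * edge_syzygy m x k)"
    proof
      fix k
      show "z k = restrict_vec {..<r} (\<lambda>k. \<Sum>x\<in>E. w x * edge_syzygy m x k) k"
        using z vz[of k] fun_cong[OF w, of "{k}"]
        by (auto simp: graph_differential_2 restrict_vec_def syzygies_def)
    qed
    also have "\<dots> = (\<lambda>k. \<Sum>x\<in>E. w x * edge_syzygy m x k)"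
      using edge_syzygy_outside[OF graph, of _ _ m, where 'k = 'k]
      by (auto simp: restrict_vec_def fun_eq_iff)
    finally show "z \<in> edge_span m E" by (intro edge_spanI) simp
  qed
  show "w x = 0" if rel: "\<And>k. (\<Sum>x\<in>E. w x * edge_syzygy m x k) = 0" and x: "x \<in> E"
    for w :: "nat set \<Rightarrow> ('n, 'k) polynomial" and x
  proof -
    have "?d 2 (restrict_vec (?B 2) w) = (\<lambda>_. 0)"
      unfolding differential_restrict using rel by (auto simp: graph_differential_2 fun_eq_iff)
    then have "restrict_vec (?B 2) w \<in> range (?d 3)"
      using exact[of 2] by auto
    then have "restrict_vec E w = (\<lambda>_. 0)"
      using differential_empty[of ?B 3] by auto
    then show ?thesis using x by (metis restrict_vec_in)
  qed
qed

text \<open>The complex of the graph without its last term \<open>S\<close>, augmented by the generators of \<open>I\<close>. The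
  definition of projective dimension asks for bases consisting of natural numbers, so the edges are
  numbered by \<open>h\<close>, with inverse \<open>g\<close>.\<close>

lemma graph_resolution_truncates:
  fixes I :: "('n, 'k::field) polynomial set"
  assumes graph: "graph {..<r} E" and gens: "min_mono_gens I r m"
    and res: "free_resolution UNIV I (graph_basis r E) (graph_diff m)"
  obtains B :: "nat \<Rightarrow> nat set" and D
  where "min_free_resolution I {0} B D" and "\<And>i. i \<ge> 2 \<Longrightarrow> B i = {}"
proof -
  have finE: "finite E" using graph by (rule graph_finite)
  then obtain h where h: "bij_betw h {0..<card E} E" using ex_bij_betw_nat_finite by blast
  define g where "g = inv_into {0..<card E} h"
  have g: "g x < card E" "h (g x) = x" if "x \<in> E" for x
    using that h inv_into_into[of x h "{0..<card E}"] f_inv_into_f[of x h "{0..<card E}"]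
    by (auto simp: bij_betw_def g_def)
  have gh: "g (h c) = c" "h c \<in> E" if "c < card E" for c
    using that h by (auto simp: bij_betw_def g_def)
  define B :: "nat \<Rightarrow> nat set"
    where "B i = (if i = 0 then {..<r} else if i = 1 then {..<card E} else {})" for i
  define D :: "nat \<Rightarrow> nat \<Rightarrow> nat \<Rightarrow> ('n, 'k) polynomial"
    where "D i k c = edge_syzygy m (h c) k" for i k c
  let ?d = "differential B D"
  have B: "B 0 = {..<r}" "B (Suc 0) = {..<card E}" "\<And>i. i \<ge> 2 \<Longrightarrow> B i = {}"
    by (auto simp: B_def)
  have sum_h: "(\<Sum>c<card E. f (h c)) = (\<Sum>x\<in>E. f x)" for f :: "nat set \<Rightarrow> ('n, 'k) polynomial"
    using sum.reindex_bij_betw[OF h, of f] by (simp add: atLeast0LessThan)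
  have d1: "?d (Suc 0) v = (\<lambda>k. \<Sum>x\<in>E. v (g x) * edge_syzygy m x k)" for v
  proof
    fix k
    have "(\<Sum>c<card E. v c * edge_syzygy m (h c) k) = (\<Sum>c<card E. v (g (h c)) * edge_syzygy m (h c) k)"
      by (intro sum.cong) (auto simp: gh)
    also have "\<dots> = (\<Sum>x\<in>E. v (g x) * edge_syzygy m x k)" by (rule sum_h)
    finally have "(\<Sum>c<card E. v c * edge_syzygy m (h c) k) = (\<Sum>x\<in>E. v (g x) * edge_syzygy m x k)" .
    moreover have "(\<Sum>x\<in>E. v (g x) * edge_syzygy m x k) = 0" if "\<not> k < r"
      using edge_syzygy_outside[OF graph _ that, of _ m, where 'k = 'k] by simp
    ultimately show "?d (Suc 0) v k = (\<Sum>x\<in>E. v (g x) * edge_syzygy m x k)"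
      by (simp add: differential_def B D_def mult.commute)
  qed
  have d_high: "?d i v = (\<lambda>_. 0)" if "i \<ge> 2" for i v
    using that B by (intro differential_empty)
  have span: "z \<in> range (?d (Suc 0))" if "z \<in> syzygies r m" for z
  proof -
    obtain w where w: "z = (\<lambda>k. \<Sum>x\<in>E. w x * edge_syzygy m x k)"
      using graph_complex_resolution_exact(1)[OF graph res] \<open>z \<in> syzygies r m\<close>
      by (blast elim: edge_spanE)
    have "z = ?d (Suc 0) (\<lambda>c. w (h c))"
      unfolding d1 w by (intro ext sum.cong) (auto simp: g)
    then show ?thesis by (rule range_eqI[where f = "?d (Suc 0)"])
  qed
  have syz: "?d (Suc 0) v \<in> syzygies r m" for v
  proof -
    have "(\<Sum>k<r. (\<Sum>x\<in>E. v (g x) * edge_syzygy m x k) * monomial (m k)) =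
        (\<Sum>x\<in>E. v (g x) * (\<Sum>k<r. edge_syzygy m x k * monomial (m k)))"
      by (rule sum_mult_assoc)
    also have "\<dots> = 0"
      using edge_syzygy_in_syzygies[OF graph, of _ m, where 'k = 'k] by (intro sum.neutral) (auto simp: syzygies_def)
    finally show ?thesis
      using edge_syzygy_outside[OF graph, of _ _ m, where 'k = 'k] by (auto simp: syzygies_def d1)
  qed
  have inj: "v = (\<lambda>_. 0)" if v: "v \<in> free_module (B (Suc 0))" "?d (Suc 0) v = (\<lambda>_. 0)" for v
  proof
    fix c
    have zero: "v (g x) = 0" if "x \<in> E" for x
      using graph_complex_resolution_exact(2)[OF graph res, of "\<lambda>x. v (g x)" x] that
        fun_cong[OF v(2)[unfolded d1]] by blast
    show "v c = 0"
      using zero[of "h c"] gh[of c] v(1) by (cases "c < card E") (auto simp: free_module_def B)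
  qed
  have I_eq: "I = range (\<lambda>v. \<Sum>k<r. v k * monomial (m k))"
    using gens ideal_gen_finite_range[of "{..<r}" "\<lambda>k. monomial (m k)"]
    by (simp add: min_mono_gens_def image_image)
  have onto: "{(\<Sum>b\<in>B 0. v b * monomial (m b)) + y |v y. v \<in> free_module (B 0) \<and> y \<in> {0}} = I"
  proof (intro equalityI subsetI)
    fix p assume "p \<in> I"
    then obtain v where "p = (\<Sum>k<r. v k * monomial (m k))" unfolding I_eq by (rule rangeE)
    then have "p = (\<Sum>k\<in>B 0. restrict_vec (B 0) v k * monomial (m k)) + 0"
      by (auto simp: B intro!: sum.cong)
    then show "p \<in> {(\<Sum>b\<in>B 0. v b * monomial (m b)) + y |v y. v \<in> free_module (B 0) \<and> y \<in> {0}}"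
      using restrict_vec_free by blast
  qed (auto simp: I_eq B)
  have "free_resolution I {0} B D"
    unfolding free_resolution_def image_differential
  proof (intro conjI allI impI exI[of _ "\<lambda>k. monomial (m k)"] onto)
    show "finite (B i)" for i by (simp add: B_def)
    show "(\<lambda>k. monomial (m k)) ` B 0 \<subseteq> I"
      using gens by (auto simp: min_mono_gens_def ideal_gen_def B intro!: ideal.span_base)
    show "{v \<in> free_module (B 0). (\<Sum>b\<in>B 0. v b * monomial (m b)) \<in> {0}} = range (?d 1)"
    proof -
      have "{v \<in> free_module (B 0). (\<Sum>b\<in>B 0. v b * monomial (m b)) \<in> {0}} = syzygies r m"
        by (auto simp: free_module_def syzygies_def B)
      then show ?thesis using span syz by auto
    qed
    show "{v \<in> free_module (B i). ?d i v = (\<lambda>_. 0)} = range (?d (i + 1))" if "i \<ge> 1" for i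
    proof (cases "i = 1")
      case True
      then show ?thesis using inj d_high[of 2] d1 by (auto simp: free_module_def numeral_2_eq_2)
    next
      case False
      then show ?thesis using that d_high[of i] d_high[of "i + 1"] B(3)[of i] by (auto simp: free_module_def)
    qed
  qed
  moreover have "?d (i + 1) v a \<in> max_ideal" for i v a
  proof (cases "i = 0")
    case True
    have "edge_syzygy m x a * v (g x) \<in> max_ideal" if "x \<in> E" for x
      using edge_syzygy_in_max_ideal[OF graph gens that] by (rule max_ideal_closed(3))
    then show ?thesis using True by (auto simp: d1 mult.commute intro!: max_ideal_closed(4))
  next
    case False
    then show ?thesis using d_high[of "i + 1" v] by (simp add: max_ideal_closed(1))
  qed
  ultimately have "min_free_resolution I {0} B D"
    unfolding min_free_resolution_def image_differential
    by (auto simp: free_module_def differential_def)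
  then show thesis using B(3) by (rule that)
qed

lemma proj_dim_le_1_iff:
  "proj_dim X Y \<le> 1 \<longleftrightarrow>
    (\<exists>(B :: nat \<Rightarrow> nat set) D. min_free_resolution X Y B D \<and> (\<forall>i\<ge>2. B i = {}))"
proof -
  have less_2: "x < 2 \<longleftrightarrow> x \<le> 1" for x :: enat
    by (cases x) (auto simp: one_enat_def numeral_eq_enat)
  have length: "Sup (enat ` {i. B i \<noteq> {}}) \<le> 1 \<longleftrightarrow> (\<forall>i\<ge>2. B i = {})" for B :: "nat \<Rightarrow> nat set"
    by (auto simp: Sup_le_iff one_enat_def)
  \<comment> \<open>An infimum is below a strict bound exactly when some element is.\<close>
  have "proj_dim X Y < 2 \<longleftrightarrow> (\<exists>(B :: nat \<Rightarrow> nat set) D.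
      min_free_resolution X Y B D \<and> Sup (enat ` {i. B i \<noteq> {}}) < 2)"
    unfolding proj_dim_def Inf_less_iff by auto
  then show ?thesis by (simp only: less_2 length)
qed

theorem theorem16:
  fixes I :: "('n::finite, 'k::field) polynomial set"
  assumes "monomial_ideal I" and "I \<noteq> UNIV"
  shows "proj_dim I {0} \<le> 1 \<longleftrightarrow> min_resolution_supported_on_tree I"
proof
  assume "proj_dim I {0} \<le> 1"
  then obtain B :: "nat \<Rightarrow> nat set" and D where "min_free_resolution I {0} B D" "B 2 = {}"
    unfolding proj_dim_le_1_iff by blast
  then show "min_resolution_supported_on_tree I"
    using short_resolution_imp_tree[OF assms] unfolding min_free_resolution_def by blast
next
  assume "min_resolution_supported_on_tree I"
  then obtain r m E where "min_mono_gens I r m" "graph {..<r} E"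
    "free_resolution UNIV I (graph_basis r E) (graph_diff m)"
    unfolding min_resolution_supported_on_tree_def tree_def min_free_resolution_def by blast
  then show "proj_dim I {0} \<le> 1"
    unfolding proj_dim_le_1_iff using graph_resolution_truncates by metis
qed

end
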